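(* Let $n\ge2$, $T\ge2$, $G=([T],\mathcal{E})$ a connected undirected graph with incidence matrix $D$ (any orientation), Laplacian $L=D^\top D$ with eigenvalues $\lambda_1\ge\cdots\ge\lambda_{T-1}>\lambda_T=0$, and $M=D\otimes I_n$. For each $t\in[T]$ let $G_t=([n],\mathcal{E}_t)$ be an undirected graph and $C_t\in\{-1,1,0\}^{|\mathcal{E}_t|\times n}$ the incidence matrix of some orientation of its edges; let $x_t\in\mathbb{R}^n$ with $\mathbf{1}_n^\top x_t=0$, and $y_t=C_tx_t+\eta_t$. Let $x,\eta,y$ be the column-stackings, $C=\mathrm{blockdiag}(C_1,\dots,C_T)$, $O_T^\top O_T=\sum_tC_t^\top C_t$, and $P=I_T\otimes(I_n-\frac1n\mathbf{1}_n\mathbf{1}_n^\top)$. Assume $\lambda_{n-1}(O_T^\top O_T)>0$, $\eta$ is a centered $\sigma$-subgaussian random vector, and $\|Mx\|_2^2\le S_T$. Let $b_1,b_2,b_3>0$ satisfy $$\lambda_{T-1}\ge b_1,\qquad\frac{\lambda_{n-1}(O_T^\top O_T)}{T}\ge b_2,\qquad 2\|C\|_2\frac{\lambda_{\max}^{1/2}(O_T^\top O_T)}{\sqrt T}\le b_3,$$ and for $\mu>0$ define $$\overline{\lambda'}(\mu)=\begin{cases}\dfrac{b_2^2}{2(b_2^2+b_3^2)}\mu b_1, & \text{if } \mu b_1<b_2+\dfrac{b_3^2-b_2^2}{2b_2},\\[2mm] \dfrac14\Big(1-\dfrac{\mu b_1-b_2}{\sqrt{b_3^2+(\mu b_1-b_2)^2}}\Big)\mu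 b_1+\dfrac{b_2}{4}+\dfrac{b_2(\mu b_1-b_2)-b_3^2}{4\sqrt{b_3^2+(\mu b_1-b_2)^2}}, & \text{otherwise,}\end{cases}$$ and $\overline{\lambda}(\mu)=\max\{\overline{\lambda'}(\mu),\lambda_{T(n-1)}(C^\top C)\}$. Let $\mu>0$. Then: (1) $\lambda_{T(n-1)}\big(P(\mu M^\top M+C^\top C)P\big)\ge\overline{\lambda}(\mu)$, and $\overline{\lambda'}(\mu)>0$; if $\mu b_1\ge b_2+\frac{b_3^2}{b_2}$ then $\overline{\lambda'}(\mu)\ge\frac{b_2}{4}$. (2) Let $\hat x=\big(P(\mu M^\top M+C^\top C)P\big)^\dagger C^\top y$. For any $\delta\in(0,e^{-1})$, with probability at least $1-\delta$, $$\|\hat x-x\|_2^2\le\frac{4\mu}{\overline{\lambda}(\mu)}S_T+40n\sigma^2\|C\|_2^2\Big(\sum_{t=1}^{T-1}\frac{1}{(\overline{\lambda}(\mu)+\mu\lambda_t)^2}+\frac{1}{\overline{\lambda}^2(\mu)}\Big)\log\Big(\frac1\delta\Big).$$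
   Context: Eigenvalues of an $N\times N$ symmetric matrix are ordered $\lambda_1\ge\cdots\ge\lambda_N$. $A^\dagger$ is the Moore–Penrose pseudoinverse. A random vector $Y$ is centered $\sigma$-subgaussian if $\mathbb{E}[Y]=0$ and $\mathbb{E}[e^{s\,u^\top Y}]\le e^{s^2\sigma^2/2}$ for all real $s$ and unit vectors $u$. $\hat x$ is the unique minimizer of $\frac12\|y-Cz\|_2^2+\frac\mu2\|Mz\|_2^2$ over $z$ in the column space of $P$. *)

theory Defs
  imports "HOL-Probability.Probability" "Jordan_Normal_Form.Char_Poly"
begin

text \<open>An oriented simple undirected graph on vertex set {0..<N} is given by a list of
  directed edges (a,b), one per undirected edge {a,b}; the list order fixes the row order
  of the incidence matrix.\<close>

definition simple_oriented_graph :: "nat \<Rightarrow> (nat \<times> nat) list \<Rightarrow> bool" where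
  "simple_oriented_graph N es \<longleftrightarrow>
     (\<forall>(a,b)\<in>set es. a < N \<and> b < N \<and> a \<noteq> b) \<and>
     distinct (map (\<lambda>(a,b). {a,b}) es)"

definition graph_adj :: "(nat \<times> nat) list \<Rightarrow> nat \<Rightarrow> nat \<Rightarrow> bool" where
  "graph_adj es i j \<longleftrightarrow> (i,j) \<in> set es \<or> (j,i) \<in> set es"

definition graph_connected :: "nat \<Rightarrow> (nat \<times> nat) list \<Rightarrow> bool" where
  "graph_connected N es \<longleftrightarrow> (\<forall>i<N. \<forall>j<N. (graph_adj es)\<^sup>*\<^sup>* i j)"

definition inc_mat :: "nat \<Rightarrow> (nat \<times> nat) list \<Rightarrow> real mat" where
  "inc_mat N es = mat (length es) N
     (\<lambda>(k,v). if v = fst (es ! k) then 1 else if v = snd (es ! k) then -1 else 0)"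

definition kron :: "real mat \<Rightarrow> real mat \<Rightarrow> real mat" where
  "kron A B = mat (dim_row A * dim_row B) (dim_col A * dim_col B)
     (\<lambda>(i,j). A $$ (i div dim_row B, j div dim_col B) * B $$ (i mod dim_row B, j mod dim_col B))"

fun block_diag :: "nat \<Rightarrow> (nat \<Rightarrow> real mat) \<Rightarrow> real mat" where
  "block_diag 0 A = 0\<^sub>m 0 0"
| "block_diag (Suc k) A = four_block_mat (block_diag k A)
     (0\<^sub>m (dim_row (block_diag k A)) (dim_col (A k)))
     (0\<^sub>m (dim_row (A k)) (dim_col (block_diag k A))) (A k)"

fun stack_vec :: "nat \<Rightarrow> (nat \<Rightarrow> real vec) \<Rightarrow> real vec" where
  "stack_vec 0 v = vec 0 (\<lambda>_. 0)"
| "stack_vec (Suc k) v = stack_vec k v @\<^sub>v v k"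

fun mat_sum :: "nat \<Rightarrow> nat \<Rightarrow> (nat \<Rightarrow> real mat) \<Rightarrow> real mat" where
  "mat_sum N 0 f = 0\<^sub>m N N"
| "mat_sum N (Suc k) f = mat_sum N k f + f k"

definition vnorm :: "real vec \<Rightarrow> real" where
  "vnorm v = sqrt (\<Sum>i<dim_vec v. (vec_index v i)^2)"

definition op_norm2 :: "real mat \<Rightarrow> real" where
  "op_norm2 A = Sup {vnorm (A *\<^sub>v v) | v. v \<in> carrier_vec (dim_col A) \<and> vnorm v \<le> 1}"

text \<open>Eigenvalues with multiplicity (roots of the characteristic polynomial), in
  non-increasing order; well defined for real symmetric matrices.\<close>
definition eig_desc :: "real mat \<Rightarrow> real list" where
  "eig_desc A = (THE xs. sorted_wrt (\<ge>) xs \<and> char_poly A = (\<Prod>x\<leftarrow>xs. [:-x, 1:]))"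

text \<open>eig A k = lambda_k(A), 1-based: lambda_1 >= ... >= lambda_N.\<close>
definition eig :: "real mat \<Rightarrow> nat \<Rightarrow> real" where
  "eig A k = eig_desc A ! (k - 1)"

definition pinv :: "real mat \<Rightarrow> real mat" where
  "pinv A = (THE X. X \<in> carrier_mat (dim_col A) (dim_row A) \<and>
     A * X * A = A \<and> X * A * X = X \<and>
     transpose_mat (A * X) = A * X \<and> transpose_mat (X * A) = X * A)"

definition centered_subgaussian_vec ::
  "'a measure \<Rightarrow> nat \<Rightarrow> real \<Rightarrow> ('a \<Rightarrow> real vec) \<Rightarrow> bool" where
  "centered_subgaussian_vec Pr m \<sigma> Y \<longleftrightarrow>
     (\<forall>\<omega>\<in>space Pr. Y \<omega> \<in> carrier_vec m) \<and>
     (\<forall>i<m. (\<lambda>\<omega>. vec_index (Y \<omega>) i) \<in> borel_measurable Pr \<and>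
            integrable Pr (\<lambda>\<omega>. vec_index (Y \<omega>) i) \<and>
            (\<integral>\<omega>. vec_index (Y \<omega>) i \<partial>Pr) = 0) \<and>
     (\<forall>s::real. \<forall>u. u \<in> carrier_vec m \<and> vnorm u = 1 \<longrightarrow>
        (\<integral>\<^sup>+\<omega>. ennreal (exp (s * scalar_prod u (Y \<omega>))) \<partial>Pr)
          \<le> ennreal (exp (s^2 * \<sigma>^2 / 2)))"

definition lam_bar' :: "real \<Rightarrow> real \<Rightarrow> real \<Rightarrow> real \<Rightarrow> real" where
  "lam_bar' b1 b2 b3 \<mu> =
    (if \<mu> * b1 < b2 + (b3^2 - b2^2) / (2 * b2)
     then b2^2 / (2 * (b2^2 + b3^2)) * \<mu> * b1
     else 1/4 * (1 - (\<mu> * b1 - b2) / sqrt (b3^2 + (\<mu> * b1 - b2)^2)) * \<mu> * b1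
          + b2 / 4
          + (b2 * (\<mu> * b1 - b2) - b3^2) / (4 * sqrt (b3^2 + (\<mu> * b1 - b2)^2)))"

end

theory Submission
  imports Defs "Jordan_Normal_Form.Schur_Decomposition"
begin

text \<open>
  Write \<open>B\<close> for the regularized Gram matrix \<open>P (\<mu> M\<^sup>T M + C\<^sup>T C) P\<close>.

  Part 1. Split \<open>v \<in> range P\<close> into its time average and the rest, of norms \<open>a\<close> and \<open>b\<close>. Then
  \<open>\<parallel>M v\<parallel>\<^sup>2 \<ge> b\<^sub>1 b\<^sup>2\<close> and \<open>\<parallel>C v\<parallel>\<^sup>2 \<ge> max 0 (b\<^sub>2 a\<^sup>2 - b\<^sub>3 a b)\<close>, and minimizing over the angle gives
  \<open>\<langle>v, B v\<rangle> \<ge> 2 lam_bar' \<parallel>v\<parallel>\<^sup>2\<close>. As \<open>B\<close> vanishes on the \<open>T\<close>-dimensional kernel of \<open>P\<close>, such a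
  bound on the complement is a bound on the eigenvalue with index \<open>T (n - 1)\<close>.

  Part 2. In an eigenbasis of \<open>B\<close> the error splits into a bias, at most \<open>\<mu> \<parallel>M x\<parallel>\<^sup>2 / lbar\<close>, and the
  noise \<open>B\<^sup>\<dagger> C\<^sup>T \<eta>\<close>. By convexity of the exponential a sum of squares \<open>\<Sum>\<^sub>k \<langle>a\<^sub>k, \<eta>\<rangle>\<^sup>2\<close> has the
  exponential moments of the square of one subgaussian variable of variance proxy \<open>\<sigma>\<^sup>2 \<Sum>\<^sub>k \<parallel>a\<^sub>k\<parallel>\<^sup>2\<close>,
  which are computed by a Gaussian mixture. Here \<open>\<Sum>\<^sub>k \<parallel>a\<^sub>k\<parallel>\<^sup>2 \<le> \<parallel>C\<parallel>\<^sup>2 tr (B\<^sup>\<dagger>)\<^sup>2\<close>, and the trace is bounded by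
  Jensen's inequality for \<open>s \<mapsto> 1 / s\<^sup>2\<close>, because \<open>2 B\<close> dominates \<open>lbar + \<mu> (L \<otimes> I)\<close> on \<open>range P\<close>.
\<close>

unbundle no inner_syntax
unbundle no vec_syntax
hide_const (open) Finite_Cartesian_Product.vec Finite_Cartesian_Product.mat

section \<open>The spectral theorem for real symmetric matrices\<close>

lemma symmetric_mat_index:
  assumes "A \<in> carrier_mat N N" "transpose_mat A = A" "i < N" "j < N"
  shows "A $$ (i, j) = A $$ (j, i)"
  using assms by (metis carrier_matD index_transpose_mat(1))

text \<open>Over the complex numbers an eigenvector \<open>p + i q\<close> always exists. Symmetry
  gives \<open>\<langle>q, A p\<rangle> = \<langle>p, A q\<rangle>\<close>, which forces the
  eigenvalue to be real; then whichever of \<open>p\<close>, \<open>q\<close> is nonzero is a real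
  eigenvector.\<close>

lemma symmetric_real_eigenvector:
  fixes A :: "real mat"
  assumes A: "A \<in> carrier_mat N N" and sym: "transpose_mat A = A" and N: "N > 0"
  obtains v e where "v \<in> carrier_vec N" "v \<noteq> 0\<^sub>v N" "A *\<^sub>v v = e \<cdot>\<^sub>v v"
proof -
  let ?B = "map_mat complex_of_real A"
  have B: "?B \<in> carrier_mat N N" using A by simp
  from char_poly_factorized[OF B] obtain as
    where as: "char_poly ?B = (\<Prod>a\<leftarrow>as. [:- a, 1:])" "length as = N" by blast
  then obtain k as' where "as = k # as'" using N by (cases as) auto
  then have "poly (char_poly ?B) k = 0" using as by simp
  then have "eigenvalue ?B k" using eigenvalue_root_char_poly[OF B] by simp
  then obtain z where z: "z \<in> carrier_vec N" "z \<noteq> 0\<^sub>v N" "?B *\<^sub>v z = k \<cdot>\<^sub>v z"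
    using B unfolding eigenvalue_def eigenvector_def by auto
  define p where "p = (\<lambda>i. Re (z $ i))"
  define q where "q = (\<lambda>i. Im (z $ i))"
  have slice: "(\<Sum>j<N. complex_of_real (A $$ (i, j)) * z $ j) = k * z $ i" if "i < N" for i
    using arg_cong[OF z(3), of "\<lambda>w. w $ i"] that z(1) A
    by (simp add: scalar_prod_def atLeast0LessThan)
  have re: "(\<Sum>j<N. A $$ (i, j) * p j) = Re k * p i - Im k * q i" if "i < N" for i
    using arg_cong[OF slice[OF that], of Re] by (simp add: p_def q_def)
  have im: "(\<Sum>j<N. A $$ (i, j) * q j) = Re k * q i + Im k * p i" if "i < N" for i
    using arg_cong[OF slice[OF that], of Im] by (simp add: p_def q_def)
  have "(\<Sum>i<N. q i * (\<Sum>j<N. A $$ (i, j) * p j)) = (\<Sum>i<N. \<Sum>j<N. A $$ (j, i) * q i * p j)"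
    using symmetric_mat_index[OF A sym] by (auto simp: sum_distrib_left mult_ac intro!: sum.cong)
  also have "\<dots> = (\<Sum>i<N. p i * (\<Sum>j<N. A $$ (i, j) * q j))"
    by (subst sum.swap) (simp add: sum_distrib_left mult_ac)
  finally have "(\<Sum>i<N. q i * (Re k * p i - Im k * q i)) = (\<Sum>i<N. p i * (Re k * q i + Im k * p i))"
    using re im by simp
  then have "Im k * (\<Sum>i<N. (p i)\<^sup>2 + (q i)\<^sup>2) = 0"
    by (simp add: algebra_simps sum.distrib sum_subtractf sum_distrib_left power2_eq_square)
  moreover have "(\<Sum>i<N. (p i)\<^sup>2 + (q i)\<^sup>2) \<noteq> 0"
  proof
    assume "(\<Sum>i<N. (p i)\<^sup>2 + (q i)\<^sup>2) = 0"
    then have "\<forall>i<N. (p i)\<^sup>2 + (q i)\<^sup>2 = 0" by (subst (asm) sum_nonneg_eq_0_iff) auto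
    then have "z = 0\<^sub>v N" using z(1) by (intro eq_vecI) (auto simp: p_def q_def complex_eq_iff)
    with z(2) show False by simp
  qed
  ultimately have k: "Im k = 0" by simp
  obtain i where i: "i < N" "z $ i \<noteq> 0" using z(1,2) by (metis carrier_vecD eq_vecI index_zero_vec)
  obtain w where nz: "\<exists>i<N. w i \<noteq> 0"
    and ev: "\<And>i. i < N \<Longrightarrow> (\<Sum>j<N. A $$ (i, j) * w j) = Re k * w i"
  proof (cases "p i = 0")
    case True
    then show ?thesis using that[of q] i im k by (auto simp: p_def q_def complex_eq_iff)
  next
    case False
    then show ?thesis using that[of p] i(1) re k by auto
  qed
  define v where "v = Matrix.vec N w"
  have "v \<in> carrier_vec N" by (simp add: v_def)
  moreover have "v \<noteq> 0\<^sub>v N" 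
  proof
    assume v0: "v = 0\<^sub>v N"
    have "w i = 0" if "i < N" for i
      using that arg_cong[OF v0, of "\<lambda>u. u $ i"] by (simp add: v_def)
    with nz show False by blast
  qed
  moreover have "A *\<^sub>v v = Re k \<cdot>\<^sub>v v"
  proof (rule eq_vecI)
    show "dim_vec (A *\<^sub>v v) = dim_vec (Re k \<cdot>\<^sub>v v)" using A by (simp add: v_def)
    fix i assume "i < dim_vec (Re k \<cdot>\<^sub>v v)"
    then have "i < N" by (simp add: v_def)
    then show "(A *\<^sub>v v) $ i = (Re k \<cdot>\<^sub>v v) $ i"
      using ev A by (simp add: v_def scalar_prod_def atLeast0LessThan)
  qed
  ultimately show ?thesis using that by blast
qed

text \<open>Completes \<open>v\<close> to a basis and applies Gram-Schmidt, which leaves the first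
  vector alone; normalizing makes \<open>c\<close> the reciprocal of the norm of \<open>v\<close>.
  This is the change of basis for one deflation step.\<close>

lemma orthogonal_mat_first_col:
  fixes v :: "real vec"
  assumes v: "v \<in> carrier_vec N" "v \<noteq> 0\<^sub>v N"
  obtains W c where "W \<in> carrier_mat N N" "transpose_mat W * W = 1\<^sub>m N"
    "W * transpose_mat W = 1\<^sub>m N" "col W 0 = c \<cdot>\<^sub>v v"
proof -
  interpret cof_vec_space N "TYPE(real)" .
  define b where "b = basis_completion v"
  define ws where "ws = gram_schmidt N b"
  from basis_completion[OF v, folded b_def]
  have dist_b: "distinct b" and indep: "\<not> lin_dep (set b)" and b: "set b \<subseteq> carrier_vec N"
    and hdb: "hd b = v" and len_b: "length b = N" by auto
  have N: "N > 0" using v by (cases N) (auto intro: eq_vecI)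
  then obtain vs where bv: "b = v # vs" using hdb len_b by (cases b) auto
  from gram_schmidt_result[OF b dist_b indep refl, folded ws_def]
  have ws: "set ws \<subseteq> carrier_vec N" "corthogonal ws" "length ws = N" by (auto simp: len_b)
  have hdws: "ws ! 0 = v" using gram_schmidt_hd[OF v(1), of vs, folded bv] ws(3) N
    unfolding ws_def by (metis hd_conv_nth length_0_conv less_numeral_extra(3))
  have conj: "conjugate w = w" for w :: "real vec" by (intro eq_vecI) auto
  have wsN: "ws ! i \<in> carrier_vec N" if "i < N" for i using that ws by auto
  have orth: "(ws ! i \<bullet> ws ! j = 0) \<longleftrightarrow> i \<noteq> j" if "i < N" "j < N" for i j
    using corthogonalD[OF ws(2), of i j] that ws(3) conj by simp
  define nw where "nw = (\<lambda>w :: real vec. 1 / sqrt (w \<bullet> w))"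
  define W where "W = mat_of_cols N (map (\<lambda>w. nw w \<cdot>\<^sub>v w) ws)"
  have W: "W \<in> carrier_mat N N" unfolding W_def using ws(3)
    by (metis length_map mat_of_cols_carrier(1))
  have colW: "col W i = nw (ws ! i) \<cdot>\<^sub>v ws ! i" if "i < N" for i
    unfolding W_def using that ws wsN[OF that] by (subst col_mat_of_cols) auto
  have pos: "ws ! i \<bullet> ws ! i > 0" if "i < N" for i
  proof -
    have "ws ! i \<bullet> ws ! i \<ge> 0" by (auto simp: scalar_prod_def intro!: sum_nonneg)
    then show ?thesis using orth[OF that that] by (simp add: less_le)
  qed
  have WtW: "transpose_mat W * W = 1\<^sub>m N"
  proof (rule eq_matI)
    fix i j assume ij: "i < dim_row (1\<^sub>m N :: real mat)" "j < dim_col (1\<^sub>m N :: real mat)"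
    then have ij: "i < N" "j < N" by auto
    have "(transpose_mat W * W) $$ (i, j) = col W i \<bullet> col W j"
      using W ij by simp
    also have "\<dots> = nw (ws ! i) * nw (ws ! j) * (ws ! i \<bullet> ws ! j)"
      using smult_scalar_prod_distrib[OF wsN[OF ij(1)], of "nw (ws ! j) \<cdot>\<^sub>v ws ! j"]
        scalar_prod_smult_distrib[OF wsN[OF ij(1)] wsN[OF ij(2)]] wsN[OF ij(2)] ij
      by (simp add: colW)
    also have "\<dots> = 1\<^sub>m N $$ (i, j)"
      using orth[OF ij] pos[OF ij(1)] ij by (auto simp: nw_def)
    finally show "(transpose_mat W * W) $$ (i, j) = 1\<^sub>m N $$ (i, j)" .
  qed (use W in auto)
  moreover have "W * transpose_mat W = 1\<^sub>m N"
    using mat_mult_left_right_inverse[OF _ W WtW] W by simp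
  ultimately show ?thesis using that[OF W, of "nw v"] colW[OF N] hdws by simp
qed

text \<open>Deflation by induction on \<open>N\<close>: in an orthonormal basis starting with an
  eigenvector the first column of the matrix is \<open>e\<close> times the first unit vector, by
  symmetry so is the first row, and the remaining block is again symmetric.\<close>

lemma symmetric_diagonalization:
  fixes A :: "real mat"
  assumes "A \<in> carrier_mat N N" "transpose_mat A = A"
  shows "\<exists>U D. U \<in> carrier_mat N N \<and> D \<in> carrier_mat N N \<and> diagonal_mat D \<and>
    transpose_mat U * U = 1\<^sub>m N \<and> U * transpose_mat U = 1\<^sub>m N \<and> A = U * D * transpose_mat U"
  using assms
proof (induction N arbitrary: A)
  case 0
  then show ?case
    by (intro exI[of _ "0\<^sub>m 0 0"]) (auto simp: diagonal_mat_def)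
next
  case (Suc m A)
  let ?N = "Suc m"
  note A = Suc.prems(1)
  obtain v e where v: "v \<in> carrier_vec ?N" "v \<noteq> 0\<^sub>v ?N" "A *\<^sub>v v = e \<cdot>\<^sub>v v"
    using symmetric_real_eigenvector[OF Suc.prems] by blast
  obtain W c where W: "W \<in> carrier_mat ?N ?N" and WtW: "transpose_mat W * W = 1\<^sub>m ?N"
    and WWt: "W * transpose_mat W = 1\<^sub>m ?N" and W0: "col W 0 = c \<cdot>\<^sub>v v"
    using orthogonal_mat_first_col[OF v(1,2)] by blast
  let ?Wt = "transpose_mat W"
  have Wt: "?Wt \<in> carrier_mat ?N ?N" using W by simp
  define A' where "A' = ?Wt * A * W"
  have A': "A' \<in> carrier_mat ?N ?N" using A W by (simp add: A'_def)
  have A'_sym: "transpose_mat A' = A'"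
    using A W Wt Suc.prems(2)
    by (simp add: A'_def transpose_mult[of _ ?N ?N _ ?N] assoc_mult_mat[of _ ?N ?N _ ?N _ ?N])
  have A_eq: "A = W * A' * ?Wt"
  proof -
    have "W * A' * ?Wt = (W * ?Wt) * A * (W * ?Wt)"
      unfolding A'_def using A W Wt by (simp add: assoc_mult_mat[of _ ?N ?N _ ?N _ ?N])
    then show ?thesis using WWt A by simp
  qed
  have col0: "A' $$ (i, 0) = (if i = 0 then e else 0)" if "i < ?N" for i
  proof -
    have AW0: "A *\<^sub>v col W 0 = e \<cdot>\<^sub>v col W 0"
      using v A by (simp add: W0 mult_mat_vec[of _ ?N ?N] smult_smult_assoc mult.commute)
    have "A' $$ (i, 0) = (?Wt * (A * W)) $$ (i, 0)"
      unfolding A'_def using A W Wt by simp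
    also have "\<dots> = col W i \<bullet> (A *\<^sub>v col W 0)"
      using A W that by (simp add: mult_mat_vec_def)
    also have "\<dots> = e * (col W i \<bullet> col W 0)"
      unfolding AW0 using W that by (intro scalar_prod_smult_distrib[of _ ?N] carrier_vecI) auto
    also have "col W i \<bullet> col W 0 = (?Wt * W) $$ (i, 0)"
      using W that by simp
    also have "e * \<dots> = (if i = 0 then e else 0)" using WtW that by simp
    finally show ?thesis .
  qed
  have row0: "A' $$ (0, i) = (if i = 0 then e else 0)" if "i < ?N" for i
    using col0[OF that] symmetric_mat_index[OF A' A'_sym, of 0 i] that by simp
  define A3 where "A3 = mat m m (\<lambda>(i, j). A' $$ (Suc i, Suc j))"
  have A3: "A3 \<in> carrier_mat m m" by (simp add: A3_def)
  have "transpose_mat A3 = A3"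
    using symmetric_mat_index[OF A' A'_sym] by (intro eq_matI) (auto simp: A3_def)
  from Suc.IH[OF A3 this] obtain U3 D3 where U3: "U3 \<in> carrier_mat m m" and D3: "D3 \<in> carrier_mat m m"
    and diag: "diagonal_mat D3" and UtU3: "transpose_mat U3 * U3 = 1\<^sub>m m"
    and UUt3: "U3 * transpose_mat U3 = 1\<^sub>m m" and A3_eq: "A3 = U3 * D3 * transpose_mat U3" by blast
  \<comment> \<open>\<open>Z a X\<close> is the block diagonal matrix with blocks \<open>a\<close>
    and \<open>X\<close>. It is multiplicative in the pair and commutes with transposition, so the
    diagonalization of the small block lifts.\<close>
  define Z where "Z = (\<lambda>a (X :: real mat). four_block_mat (mat 1 1 (\<lambda>_. a)) (0\<^sub>m 1 m) (0\<^sub>m m 1) X)"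
  have Z: "Z a X \<in> carrier_mat ?N ?N" if "X \<in> carrier_mat m m" for a X
    using four_block_carrier_mat[of "mat 1 1 (\<lambda>_. a)" 1 1 X m m] that by (simp add: Z_def)
  have Z_mult: "Z a X * Z b Y = Z (a * b) (X * Y)" if "X \<in> carrier_mat m m" "Y \<in> carrier_mat m m" for a b X Y
  proof -
    have "mat 1 1 (\<lambda>_. a) * mat 1 1 (\<lambda>_. b) = (mat 1 1 (\<lambda>_. a * b) :: real mat)"
      by (intro eq_matI) (auto simp: scalar_prod_def)
    then show ?thesis unfolding Z_def using that
      by (subst mult_four_block_mat[of _ 1 1 _ m _ m _ _ 1 _ m]) auto
  qed
  have Z_t: "transpose_mat (Z a X) = Z a (transpose_mat X)" if "X \<in> carrier_mat m m" for a X
    using that by (intro eq_matI) (auto simp: Z_def)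
  have Z_one: "Z 1 (1\<^sub>m m) = 1\<^sub>m ?N" by (intro eq_matI) (auto simp: Z_def)
  have A'_eq: "A' = Z e A3"
  proof (rule eq_matI)
    fix i j assume "i < dim_row (Z e A3)" "j < dim_col (Z e A3)"
    then have ij: "i < ?N" "j < ?N" using Z[OF A3, of e] by auto
    have "Z e A3 $$ (i, j) = (if i = 0 then if j = 0 then e else 0 else if j = 0 then 0 else A3 $$ (i - 1, j - 1))"
      unfolding Z_def using ij A3 by (subst index_mat_four_block) auto
    moreover have "A' $$ (i, j) = A3 $$ (i - 1, j - 1)" if "i \<noteq> 0" "j \<noteq> 0"
      unfolding A3_def using that ij by (subst index_mat) auto
    ultimately show "A' $$ (i, j) = Z e A3 $$ (i, j)"
      using col0[OF ij(1)] row0[OF ij(2)] by (cases "i = 0"; cases "j = 0") simp_all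
  qed (use A' Z[OF A3, of e] in auto)
  define U where "U = W * Z 1 U3"
  define D where "D = Z e D3"
  have ZU: "Z 1 U3 \<in> carrier_mat ?N ?N" and D: "D \<in> carrier_mat ?N ?N"
    using Z U3 D3 by (auto simp: D_def)
  have ZUt: "Z 1 (transpose_mat U3) \<in> carrier_mat ?N ?N" using Z U3 by simp
  have U: "U \<in> carrier_mat ?N ?N" using W ZU by (simp add: U_def)
  have Ut: "transpose_mat U = Z 1 (transpose_mat U3) * ?Wt"
    unfolding U_def using W ZU U3 by (simp add: transpose_mult[of _ ?N ?N _ ?N] Z_t)
  have UtU: "transpose_mat U * U = 1\<^sub>m ?N"
  proof -
    have "transpose_mat U * U = Z 1 (transpose_mat U3) * (?Wt * W) * Z 1 U3"
      unfolding Ut unfolding U_def using W Wt ZU ZUt by (simp add: assoc_mult_mat[of _ ?N ?N _ ?N _ ?N])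
    then show ?thesis using WtW ZU ZUt U3 UtU3 by (simp add: Z_mult Z_one)
  qed
  have "U * D * transpose_mat U = W * (Z 1 U3 * D * Z 1 (transpose_mat U3)) * ?Wt"
    unfolding Ut unfolding U_def using W Wt ZU ZUt D by (simp add: assoc_mult_mat[of _ ?N ?N _ ?N _ ?N])
  also have "Z 1 U3 * D * Z 1 (transpose_mat U3) = A'"
    unfolding D_def A'_eq A3_eq using U3 D3 by (simp add: Z_mult)
  finally have "A = U * D * transpose_mat U" using A_eq by simp
  moreover have "diagonal_mat D"
    using diag D3 unfolding diagonal_mat_def D_def Z_def by auto
  moreover have "U * transpose_mat U = 1\<^sub>m ?N"
    using mat_mult_left_right_inverse[OF _ U UtU] U by simp
  ultimately show ?case using U D UtU by blast
qed

section \<open>Inner products, matrix action and orthonormal systems\<close>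

text \<open>Vectors are functions on \<open>nat\<close> of which only the first \<open>N\<close> values matter; this avoids the
  carrier side conditions of the matrix library.\<close>

definition ip :: "nat \<Rightarrow> (nat \<Rightarrow> real) \<Rightarrow> (nat \<Rightarrow> real) \<Rightarrow> real" where
  "ip N f g = (\<Sum>i<N. f i * g i)"

definition mv :: "real mat \<Rightarrow> (nat \<Rightarrow> real) \<Rightarrow> nat \<Rightarrow> real" where
  "mv A f i = (\<Sum>j<dim_col A. A $$ (i, j) * f j)"

definition orthonormal :: "nat \<Rightarrow> nat \<Rightarrow> (nat \<Rightarrow> nat \<Rightarrow> real) \<Rightarrow> bool" where
  "orthonormal N k V \<longleftrightarrow> (\<forall>i<k. \<forall>j<k. ip N (V i) (V j) = of_bool (i = j))"

text \<open>The second conjunct is the resolution of the identity. It gives expansions and Parseval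
  by interchanging sums, with no dimension argument.\<close>

definition orthobasis :: "nat \<Rightarrow> (nat \<Rightarrow> nat \<Rightarrow> real) \<Rightarrow> bool" where
  "orthobasis N V \<longleftrightarrow> orthonormal N N V \<and>
     (\<forall>i<N. \<forall>j<N. (\<Sum>k<N. V k i * V k j) = of_bool (i = j))"

lemma ip_commute: "ip N f g = ip N g f"
  by (simp add: ip_def mult.commute)

lemma ip_nonneg [simp]: "ip N f f \<ge> 0"
  by (auto simp: ip_def intro: sum_nonneg)

lemma ip_cong: "(\<And>i. i < N \<Longrightarrow> f i = f' i) \<Longrightarrow> (\<And>i. i < N \<Longrightarrow> g i = g' i) \<Longrightarrow> ip N f g = ip N f' g'"
  by (simp add: ip_def)

lemma ip_eq_0_iff: "ip N f f = 0 \<longleftrightarrow> (\<forall>i<N. f i = 0)"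
  by (auto simp: ip_def sum_nonneg_eq_0_iff)

lemma ip_simps:
  "ip N (\<lambda>i. f i + g i) h = ip N f h + ip N g h"
  "ip N h (\<lambda>i. f i + g i) = ip N h f + ip N h g"
  "ip N (\<lambda>i. f i - g i) h = ip N f h - ip N g h"
  "ip N h (\<lambda>i. f i - g i) = ip N h f - ip N h g"
  "ip N (\<lambda>i. c * f i) h = c * ip N f h"
  "ip N h (\<lambda>i. c * f i) = c * ip N h f"
  "ip N (\<lambda>i. 0) h = 0"
  "ip N h (\<lambda>i. 0) = 0"
  by (simp_all add: ip_def algebra_simps sum.distrib sum_subtractf sum_distrib_left)

lemma ip_sum_left: "ip N (\<lambda>i. \<Sum>k\<in>K. f k i) h = (\<Sum>k\<in>K. ip N (f k) h)"
  unfolding ip_def by (subst sum.swap) (simp add: sum_distrib_right)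

lemma ip_sum_right: "ip N h (\<lambda>i. \<Sum>k\<in>K. f k i) = (\<Sum>k\<in>K. ip N h (f k))"
  by (simp add: ip_commute[of N h] ip_sum_left)

lemma Cauchy_Schwarz_ip: "(ip N f g)\<^sup>2 \<le> ip N f f * ip N g g"
  unfolding ip_def using Cauchy_Schwarz_ineq_sum[of f g "{..<N}"] by (simp add: power2_eq_square)

lemma mv_simps:
  "mv A (\<lambda>i. f i + g i) = (\<lambda>i. mv A f i + mv A g i)"
  "mv A (\<lambda>i. f i - g i) = (\<lambda>i. mv A f i - mv A g i)"
  "mv A (\<lambda>i. c * f i) = (\<lambda>i. c * mv A f i)"
  by (auto simp: mv_def fun_eq_iff algebra_simps sum.distrib sum_subtractf sum_distrib_left)

lemma mv_sum: "mv A (\<lambda>i. \<Sum>k\<in>K. f k i) = (\<lambda>i. \<Sum>k\<in>K. mv A (f k) i)"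
  unfolding mv_def fun_eq_iff by (simp add: sum_distrib_left) (subst sum.swap, simp)

lemma mv_cong: "(\<And>i. i < dim_col A \<Longrightarrow> f i = g i) \<Longrightarrow> mv A f = mv A g"
  by (auto simp: mv_def fun_eq_iff)

lemma mv_index: "v \<in> carrier_vec (dim_col A) \<Longrightarrow> i < dim_row A \<Longrightarrow> (A *\<^sub>v v) $ i = mv A (($) v) i"
  by (auto simp: mv_def scalar_prod_def atLeast0LessThan)

lemma mv_adjoint:
  assumes "A \<in> carrier_mat R N"
  shows "ip N f (mv (transpose_mat A) g) = ip R (mv A f) g"
  using assms by (simp add: ip_def mv_def sum_distrib_left sum_distrib_right, subst sum.swap)
    (simp add: mult_ac)

lemma mv_mult:
  assumes "A \<in> carrier_mat R N" "B \<in> carrier_mat N K" "i < R"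
  shows "mv (A * B) f i = mv A (mv B f) i"
proof -
  have "mv (A * B) f i = (\<Sum>j<K. \<Sum>l<N. A $$ (i, l) * B $$ (l, j) * f j)"
    using assms by (auto simp: mv_def scalar_prod_def atLeast0LessThan sum_distrib_right)
  also have "\<dots> = mv A (mv B f) i"
    using assms by (subst sum.swap) (auto simp: mv_def sum_distrib_left mult_ac)
  finally show ?thesis .
qed

lemma ip_mv_gram:
  assumes "A \<in> carrier_mat R N"
  shows "ip N f (mv (transpose_mat A * A) g) = ip R (mv A f) (mv A g)"
proof -
  have "ip N f (mv (transpose_mat A * A) g) = ip N f (mv (transpose_mat A) (mv A g))"
    using assms by (intro ip_cong mv_mult[of _ N R]) auto
  then show ?thesis using mv_adjoint[OF assms] by simp
qed

lemma ip_mv_symmetric: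
  assumes "A \<in> carrier_mat N N" "transpose_mat A = A"
  shows "ip N f (mv A g) = ip N (mv A f) g"
  using mv_adjoint[OF assms(1), of f g] assms(2) by simp

lemma orthonormalD: "orthonormal N k V \<Longrightarrow> i < k \<Longrightarrow> j < k \<Longrightarrow> ip N (V i) (V j) = of_bool (i = j)"
  by (simp add: orthonormal_def)

lemma orthobasis_orthonormal: "orthobasis N V \<Longrightarrow> orthonormal N N V"
  by (simp add: orthobasis_def)

lemma orthobasis_expand:
  assumes "orthobasis N V" "i < N"
  shows "f i = (\<Sum>k<N. ip N (V k) f * V k i)"
proof -
  have "(\<Sum>k<N. ip N (V k) f * V k i) = (\<Sum>j<N. (\<Sum>k<N. V k j * V k i) * f j)"
    unfolding ip_def sum_distrib_right by (subst sum.swap) (simp add: mult_ac)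
  also have "\<dots> = (\<Sum>j<N. of_bool (j = i) * f j)"
    using assms by (intro sum.cong) (auto simp: orthobasis_def)
  also have "\<dots> = f i"
    using assms(2) by (simp add: of_bool_def if_distrib if_distribR sum.delta cong: if_cong)
  finally show ?thesis by simp
qed

lemma orthobasis_parseval:
  assumes "orthobasis N V"
  shows "ip N f g = (\<Sum>k<N. ip N (V k) f * ip N (V k) g)"
proof -
  have "ip N f g = ip N (\<lambda>i. \<Sum>k<N. ip N (V k) f * V k i) g"
    using orthobasis_expand[OF assms, of _ f] by (intro ip_cong) auto
  then show ?thesis by (simp add: ip_sum_left ip_simps)
qed

text \<open>The second claim identifies the gap in Bessel's inequality with the squared norm of the
  residual. Later a vanishing gap places an eigenvector in the span of the kernel vectors.\<close>

lemma orthonormal_bessel: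
  assumes "orthonormal N k z"
  shows "(\<Sum>j<k. (ip N (z j) f)\<^sup>2) \<le> ip N f f"
    and "ip N f f - (\<Sum>j<k. (ip N (z j) f)\<^sup>2) =
      ip N (\<lambda>i. f i - (\<Sum>j<k. ip N (z j) f * z j i)) (\<lambda>i. f i - (\<Sum>j<k. ip N (z j) f * z j i))"
proof -
  let ?p = "\<lambda>i. \<Sum>j<k. ip N (z j) f * z j i"
  have 1: "ip N f ?p = (\<Sum>j<k. (ip N (z j) f)\<^sup>2)"
    by (simp add: ip_sum_right ip_simps power2_eq_square ip_commute[of N f])
  have "ip N ?p ?p = (\<Sum>j<k. ip N (z j) f * ip N (z j) ?p)"
    by (simp add: ip_sum_left ip_simps)
  also have "\<dots> = (\<Sum>j<k. ip N (z j) f * ip N (z j) f)"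
  proof (intro sum.cong refl)
    fix j assume "j \<in> {..<k}"
    then have "ip N (z j) ?p = (\<Sum>l<k. ip N (z l) f * of_bool (j = l))"
      using assms by (auto simp: ip_sum_right ip_simps orthonormal_def intro!: sum.cong)
    also have "\<dots> = ip N (z j) f"
      using \<open>j \<in> {..<k}\<close> by (simp add: of_bool_def if_distrib sum.delta cong: if_cong)
    finally show "ip N (z j) f * ip N (z j) ?p = ip N (z j) f * ip N (z j) f" by simp
  qed
  finally have 2: "ip N ?p ?p = (\<Sum>j<k. (ip N (z j) f)\<^sup>2)" by (simp add: power2_eq_square)
  show eq: "ip N f f - (\<Sum>j<k. (ip N (z j) f)\<^sup>2) = ip N (\<lambda>i. f i - ?p i) (\<lambda>i. f i - ?p i)"
    by (simp add: ip_simps 1 2 ip_commute[of N ?p f])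
  show "(\<Sum>j<k. (ip N (z j) f)\<^sup>2) \<le> ip N f f"
    using eq ip_nonneg[of N "\<lambda>i. f i - ?p i"] by linarith
qed

lemma orthonormal_residual:
  assumes "orthonormal N k z" "l < k"
  shows "ip N (z l) (\<lambda>i. f i - (\<Sum>j<k. ip N (z j) f * z j i)) = 0"
proof -
  have "ip N (z l) (\<lambda>i. \<Sum>j<k. ip N (z j) f * z j i) = (\<Sum>j<k. ip N (z j) f * of_bool (l = j))"
    using assms by (auto simp: ip_sum_right ip_simps orthonormal_def intro!: sum.cong)
  also have "\<dots> = ip N (z l) f"
    using assms(2) by (simp add: of_bool_def if_distrib sum.delta cong: if_cong)
  finally show ?thesis by (simp add: ip_simps)
qed

section \<open>Ordered eigenvalues and eigenbases\<close>

lemma eig_desc_eqI: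
  assumes "sorted_wrt (\<ge>) xs" "char_poly A = (\<Prod>x\<leftarrow>xs. [:-x, 1:])"
  shows "eig_desc A = xs"
  unfolding eig_desc_def
proof (rule the_equality)
  fix ys assume ys: "sorted_wrt (\<ge>) ys \<and> char_poly A = (\<Prod>x\<leftarrow>ys. [:-x, 1:])"
  \<comment> \<open>A product of linear factors determines the multiset of its roots, and a multiset
    has only one sorted enumeration.\<close>
  have roots: "proots (\<Prod>x\<leftarrow>zs. [:-x, 1:]) = mset zs" for zs :: "real list"
  proof (induction zs)
    case (Cons a zs)
    have "(\<Prod>x\<leftarrow>zs. [:-x, 1:]) \<noteq> 0" by (auto simp: prod_list_zero_iff)
    then have "proots ([:-a, 1:] * (\<Prod>x\<leftarrow>zs. [:-x, 1:])) = proots [:-a, 1:] + mset zs"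
      by (subst proots_mult) (simp_all add: Cons.IH)
    then show ?case by simp
  qed simp
  have "mset (rev xs) = mset (rev ys)" using roots[of xs] roots[of ys] ys assms(2) by simp
  moreover have "sorted (rev xs)" "sorted (rev ys)"
    using assms(1) ys by (simp_all add: sorted_wrt_rev)
  ultimately have "rev xs = rev ys" by (metis properties_for_sort)
  then show "ys = xs" by simp
qed (use assms in auto)

text \<open>Positions are 0-based and eigenvalues 1-based: \<open>V k\<close> belongs to
  \<open>eig A (Suc k)\<close>.\<close>

locale symmetric_eigenbasis =
  fixes A :: "real mat" and N :: nat and V :: "nat \<Rightarrow> nat \<Rightarrow> real"
  assumes carrier: "A \<in> carrier_mat N N"
    and symmetric: "transpose_mat A = A"
    and basis: "orthobasis N V"
    and eigen: "\<And>k i. k < N \<Longrightarrow> i < N \<Longrightarrow> mv A (V k) i = eig A (Suc k) * V k i"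
    and decreasing: "\<And>k l. k \<le> l \<Longrightarrow> l < N \<Longrightarrow> eig A (Suc l) \<le> eig A (Suc k)"

theorem spectral_theorem:
  fixes A :: "real mat"
  assumes A: "A \<in> carrier_mat N N" and sym: "transpose_mat A = A"
  obtains V where "symmetric_eigenbasis A N V"
proof -
  from symmetric_diagonalization[OF A sym] obtain U D
    where U: "U \<in> carrier_mat N N" and D: "D \<in> carrier_mat N N" and diag: "diagonal_mat D"
      and UtU: "transpose_mat U * U = 1\<^sub>m N" and UUt: "U * transpose_mat U = 1\<^sub>m N"
      and eq: "A = U * D * transpose_mat U" by blast
  define d where "d = (\<lambda>i. D $$ (i, i))"
  \<comment> \<open>Lists the columns of \<open>U\<close> by non-increasing diagonal entry, so that
    they line up with \<open>eig_desc\<close>.\<close>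
  define ks where "ks = rev (sort_key d [0..<N])"
  have ks: "length ks = N" "distinct ks" "set ks = {..<N}"
    by (auto simp: ks_def)
  have sorted: "sorted_wrt (\<ge>) (map d ks)"
    unfolding ks_def rev_map[symmetric] by (simp add: sorted_wrt_rev)
  have "similar_mat A D"
    using A D U UtU UUt eq unfolding similar_mat_def
    by (intro exI[of _ U] exI[of _ "transpose_mat U"] similar_mat_witI[of _ _ N]) auto
  then have "char_poly A = char_poly D" by (rule char_poly_similar)
  also have "\<dots> = (\<Prod>a\<leftarrow>diag_mat D. [:- a, 1:])"
    using diag D by (intro char_poly_upper_triangular[of _ N])
      (auto simp: diagonal_mat_def upper_triangular_def)
  also have "\<dots> = (\<Prod>x\<leftarrow>map d [0..<N]. [:-x, 1:])"
    using D by (simp add: diag_mat_def d_def)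
  also have "\<dots> = (\<Prod>x\<leftarrow>map d ks. [:-x, 1:])"
    unfolding prod_mset_prod_list[symmetric] by (simp add: ks_def)
  finally have desc: "eig_desc A = map d ks" using sorted by (intro eig_desc_eqI)
  have eig: "eig A (Suc k) = d (ks ! k)" if "k < N" for k
    using that ks by (simp add: eig_def desc)
  have ksN: "ks ! k < N" if "k < N" for k using that ks nth_mem[of k ks] by auto
  define V where "V = (\<lambda>k i. U $$ (i, ks ! k))"
  have "orthonormal N N V"
    unfolding orthonormal_def
  proof (intro allI impI)
    fix i j assume ij: "i < N" "j < N"
    have "ip N (V i) (V j) = (transpose_mat U * U) $$ (ks ! i, ks ! j)"
      using U ksN ij by (simp add: ip_def V_def scalar_prod_def atLeast0LessThan)
    then show "ip N (V i) (V j) = of_bool (i = j)"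
      using UtU ksN ij ks by (simp add: nth_eq_iff_index_eq)
  qed
  moreover have "(\<Sum>k<N. V k i * V k j) = of_bool (i = j)" if "i < N" "j < N" for i j
  proof -
    have "bij_betw ((!) ks) {..<N} {..<N}"
      by (rule bij_betw_nth) (simp_all only: ks)
    then have "(\<Sum>k<N. V k i * V k j) = (\<Sum>k<N. U $$ (i, k) * U $$ (j, k))"
      unfolding V_def by (rule sum.reindex_bij_betw)
    also have "\<dots> = (U * transpose_mat U) $$ (i, j)"
      using U that by (simp add: scalar_prod_def atLeast0LessThan)
    finally show ?thesis using UUt that by simp
  qed
  ultimately have "orthobasis N V" by (simp add: orthobasis_def)
  moreover have "mv A (V k) i = eig A (Suc k) * V k i" if ki: "k < N" "i < N" for k i
  proof -
    have AU: "A * U = U * D"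
    proof -
      have "A * U = U * D * (transpose_mat U * U)"
        unfolding eq using U D by (intro assoc_mult_mat[of _ N N _ N _ N]) auto
      then show ?thesis using UtU U D by simp
    qed
    have "mv A (V k) i = (A * U) $$ (i, ks ! k)"
      using A U ksN ki by (simp add: mv_def V_def scalar_prod_def atLeast0LessThan)
    also have "\<dots> = (\<Sum>l<N. U $$ (i, l) * D $$ (l, ks ! k))"
      using U D ksN ki by (simp add: AU scalar_prod_def atLeast0LessThan)
    also have "\<dots> = (\<Sum>l<N. if l = ks ! k then U $$ (i, l) * d l else 0)"
      using diag D ksN ki by (intro sum.cong) (auto simp: diagonal_mat_def d_def)
    also have "\<dots> = eig A (Suc k) * V k i"
      using ksN ki eig by (simp add: sum.delta V_def)
    finally show ?thesis .
  qed
  moreover have "eig A (Suc l) \<le> eig A (Suc k)" if "k \<le> l" "l < N" for k l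
    using sorted that ks eig by (cases "k = l") (auto simp: sorted_wrt_iff_nth_less)
  ultimately have "symmetric_eigenbasis A N V"
    using A sym by unfold_locales auto
  then show ?thesis by (rule that)
qed

section \<open>Symmetric matrices with a prescribed kernel\<close>

context symmetric_eigenbasis
begin

lemma norm_basis: "k < N \<Longrightarrow> ip N (V k) (V k) = 1"
  using basis by (simp add: orthobasis_def orthonormal_def)

lemma ip_basis_image: "k < N \<Longrightarrow> ip N (V k) (mv A f) = eig A (Suc k) * ip N (V k) f"
  using ip_mv_symmetric[OF carrier symmetric, of "V k" f] ip_cong[of N "mv A (V k)" "\<lambda>i. eig A (Suc k) * V k i" f f]
  by (simp add: eigen ip_simps)

lemma quadratic_form: "ip N f (mv A g) = (\<Sum>k<N. eig A (Suc k) * ip N (V k) f * ip N (V k) g)"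
  unfolding orthobasis_parseval[OF basis, of f "mv A g"]
  by (intro sum.cong) (auto simp: ip_basis_image)

lemma eig_eq_rayleigh: "k < N \<Longrightarrow> eig A (Suc k) = ip N (V k) (mv A (V k))"
  by (simp add: ip_basis_image norm_basis)

lemma quadratic_form_le: "N > 0 \<Longrightarrow> ip N f (mv A f) \<le> eig A 1 * ip N f f"
  unfolding quadratic_form orthobasis_parseval[OF basis, of f f] sum_distrib_left
  using decreasing[of 0] by (intro sum_mono) (auto simp: mult.assoc intro!: mult_right_mono)

text \<open>With the convention \<open>inverse 0 = 0\<close>, inverting the eigenvalues gives the pseudoinverse.\<close>

definition spec_mat :: "(nat \<Rightarrow> real) \<Rightarrow> real mat" where
  "spec_mat d = mat N N (\<lambda>(i, j). \<Sum>k<N. d k * V k i * V k j)"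

lemma spec_mat_carrier [simp]: "spec_mat d \<in> carrier_mat N N"
  by (simp add: spec_mat_def)

lemma spec_mat_transpose: "transpose_mat (spec_mat d) = spec_mat d"
  by (intro eq_matI) (auto simp: spec_mat_def mult_ac)

lemma mv_spec_mat: "i < N \<Longrightarrow> mv (spec_mat d) f i = (\<Sum>k<N. d k * ip N (V k) f * V k i)"
  by (simp add: mv_def spec_mat_def ip_def sum_distrib_left sum_distrib_right, subst sum.swap)
    (simp add: mult_ac)

lemma spec_mat_mult: "spec_mat d * spec_mat e = spec_mat (\<lambda>k. d k * e k)"
proof (rule eq_matI)
  fix i j assume "i < dim_row (spec_mat (\<lambda>k. d k * e k))" "j < dim_col (spec_mat (\<lambda>k. d k * e k))"
  then have ij: "i < N" "j < N" by (simp_all add: spec_mat_def)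
  have col: "ip N (V k) (\<lambda>l. spec_mat e $$ (l, j)) = e k * V k j" if "k < N" for k
  proof -
    have "ip N (V k) (\<lambda>l. spec_mat e $$ (l, j)) = ip N (V k) (\<lambda>l. \<Sum>m<N. e m * V m j * V m l)"
      using ij by (intro ip_cong) (auto simp: spec_mat_def mult_ac)
    also have "\<dots> = (\<Sum>m<N. e m * V m j * of_bool (k = m))"
      using that orthonormalD[OF orthobasis_orthonormal[OF basis]]
      by (auto simp: ip_sum_right ip_simps intro!: sum.cong)
    also have "\<dots> = e k * V k j"
      using that by (simp add: of_bool_def if_distrib sum.delta cong: if_cong)
    finally show ?thesis .
  qed
  have "(spec_mat d * spec_mat e) $$ (i, j) = mv (spec_mat d) (\<lambda>l. spec_mat e $$ (l, j)) i"
    using ij by (simp add: spec_mat_def mv_def scalar_prod_def atLeast0LessThan)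
  also have "\<dots> = (\<Sum>k<N. d k * (e k * V k j) * V k i)"
    using ij col by (simp add: mv_spec_mat)
  finally show "(spec_mat d * spec_mat e) $$ (i, j) = spec_mat (\<lambda>k. d k * e k) $$ (i, j)"
    using ij by (simp add: spec_mat_def mult_ac)
qed (auto simp: spec_mat_def)

lemma spec_mat_eig: "spec_mat (\<lambda>k. eig A (Suc k)) = A"
proof (rule eq_matI)
  fix i j assume "i < dim_row A" "j < dim_col A"
  then have ij: "i < N" "j < N" using carrier by auto
  have mvA: "mv A (V k) i = eig A (Suc k) * V k i" if "k < N" for k using eigen that ij by simp
  have "A $$ (i, j) = (\<Sum>l<N. A $$ (i, l) * of_bool (l = j))"
    using ij by (simp add: of_bool_def if_distrib sum.delta cong: if_cong)
  also have "\<dots> = (\<Sum>l<N. A $$ (i, l) * (\<Sum>k<N. V k l * V k j))"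
    using basis ij by (intro sum.cong) (auto simp: orthobasis_def)
  also have "\<dots> = (\<Sum>k<N. mv A (V k) i * V k j)"
    using carrier by (simp add: mv_def sum_distrib_left sum_distrib_right, subst sum.swap)
      (simp add: mult_ac)
  also have "\<dots> = spec_mat (\<lambda>k. eig A (Suc k)) $$ (i, j)"
    using ij mvA by (simp add: spec_mat_def)
  finally show "spec_mat (\<lambda>k. eig A (Suc k)) $$ (i, j) = A $$ (i, j)" by simp
qed (use carrier in \<open>auto simp: spec_mat_def\<close>)

text \<open>Existence is a scalar matter: \<open>e * inverse e * e = e\<close> holds also for
  \<open>e = 0\<close>. Uniqueness is the classical argument from the symmetry of the two
  products.\<close>

lemma pinv_eq: "pinv A = spec_mat (\<lambda>k. inverse (eig A (Suc k)))"
  unfolding pinv_def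
proof (rule the_equality)
  let ?K = "spec_mat (\<lambda>k. inverse (eig A (Suc k)))"
  have mult: "A * ?K = spec_mat (\<lambda>k. eig A (Suc k) * inverse (eig A (Suc k)))"
    "?K * A = spec_mat (\<lambda>k. inverse (eig A (Suc k)) * eig A (Suc k))"
    using spec_mat_mult spec_mat_eig by metis+
  have "A * ?K * A = spec_mat (\<lambda>k. eig A (Suc k) * inverse (eig A (Suc k)) * eig A (Suc k))"
    using mult spec_mat_mult spec_mat_eig by metis
  also have "(\<lambda>k. eig A (Suc k) * inverse (eig A (Suc k)) * eig A (Suc k)) = (\<lambda>k. eig A (Suc k))"
  proof
    show "eig A (Suc k) * inverse (eig A (Suc k)) * eig A (Suc k) = eig A (Suc k)" for k
      by (cases "eig A (Suc k) = 0") simp_all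
  qed
  also note spec_mat_eig
  finally have 1: "A * ?K * A = A" .
  have "?K * A * ?K = spec_mat (\<lambda>k. inverse (eig A (Suc k)) * eig A (Suc k) * inverse (eig A (Suc k)))"
    using mult spec_mat_mult by metis
  also have "(\<lambda>k. inverse (eig A (Suc k)) * eig A (Suc k) * inverse (eig A (Suc k))) = (\<lambda>k. inverse (eig A (Suc k)))"
  proof
    show "inverse (eig A (Suc k)) * eig A (Suc k) * inverse (eig A (Suc k)) = inverse (eig A (Suc k))" for k
      by (cases "eig A (Suc k) = 0") simp_all
  qed
  finally have 2: "?K * A * ?K = ?K" .
  have 3: "transpose_mat (A * ?K) = A * ?K" "transpose_mat (?K * A) = ?K * A"
    unfolding mult by (simp_all add: spec_mat_transpose)
  show "?K \<in> carrier_mat (dim_col A) (dim_row A) \<and> A * ?K * A = A \<and> ?K * A * ?K = ?K \<and>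
     transpose_mat (A * ?K) = A * ?K \<and> transpose_mat (?K * A) = ?K * A"
    using 1 2 3 carrier by auto
  fix X assume X: "X \<in> carrier_mat (dim_col A) (dim_row A) \<and> A * X * A = A \<and> X * A * X = X \<and>
     transpose_mat (A * X) = A * X \<and> transpose_mat (X * A) = X * A"
  have c: "A \<in> carrier_mat N N" "X \<in> carrier_mat N N" "?K \<in> carrier_mat N N"
    using carrier X by auto
  note assoc = assoc_mult_mat[of _ N N _ N _ N]
  have tr: "transpose_mat (P * Q) = transpose_mat Q * transpose_mat P"
    if "P \<in> carrier_mat N N" "Q \<in> carrier_mat N N" for P Q :: "real mat"
    using that by (rule transpose_mult)
  \<comment> \<open>Transposing reverses the two symmetric factors, and
    \<open>(A * X) * (A * ?K) = A * ?K\<close> because \<open>A * X * A = A\<close>. The products in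
    the other order are treated in the same way.\<close>
  have "A * X = (A * ?K) * (A * X)" using c 1 by (metis assoc mult_carrier_mat)
  then have "A * X = transpose_mat ((A * X) * (A * ?K))"
    using X 3 c by (metis tr mult_carrier_mat)
  also have "(A * X) * (A * ?K) = A * ?K" using c X by (metis assoc mult_carrier_mat)
  finally have AX: "A * X = A * ?K" using 3 by simp
  have "X * A = (X * A) * (?K * A)" using c 1 by (metis assoc mult_carrier_mat)
  then have "X * A = transpose_mat ((?K * A) * (X * A))"
    using X 3 c by (metis tr mult_carrier_mat)
  also have "(?K * A) * (X * A) = ?K * A" using c X by (metis assoc mult_carrier_mat)
  finally have XA: "X * A = ?K * A" using 3 by simp
  have "X = X * A * X" using X by simp
  also have "\<dots> = ?K * (A * X)" using c by (simp add: XA assoc)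
  also have "\<dots> = ?K * A * ?K" using c by (simp add: AX assoc)
  finally show "X = ?K" using 2 by simp
qed

lemma mv_pinv: "i < N \<Longrightarrow> mv (pinv A) f i = (\<Sum>k<N. inverse (eig A (Suc k)) * ip N (V k) f * V k i)"
  by (simp add: pinv_eq mv_spec_mat)

end

section \<open>Coercivity relative to known kernel vectors\<close>

definition orth_to :: "nat \<Rightarrow> nat \<Rightarrow> (nat \<Rightarrow> nat \<Rightarrow> real) \<Rightarrow> (nat \<Rightarrow> real) \<Rightarrow> bool" where
  "orth_to N r z v \<longleftrightarrow> (\<forall>j<r. ip N (z j) v = 0)"

text \<open>The \<open>z j\<close> are only known to lie in the kernel, which may be larger.
  Positivity of \<open>eig A (N - r)\<close>, or coercivity on their complement, is what shows below
  that they span it.\<close>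

locale eigenbasis_with_kernel = symmetric_eigenbasis +
  fixes r :: nat and z :: "nat \<Rightarrow> nat \<Rightarrow> real"
  assumes kernel_orthonormal: "orthonormal N r z"
    and kernel: "\<And>j i. j < r \<Longrightarrow> i < N \<Longrightarrow> mv A (z j) i = 0"
    and rank: "r < N"
begin

abbreviation perp :: "(nat \<Rightarrow> real) \<Rightarrow> bool" where
  "perp \<equiv> orth_to N r z"

lemma perp_basis:
  assumes "k < N" "eig A (Suc k) \<noteq> 0"
  shows "perp (V k)"
  unfolding orth_to_def
proof (intro allI impI)
  fix j assume j: "j < r"
  have "eig A (Suc k) * ip N (V k) (z j) = ip N (V k) (mv A (z j))"
    using assms by (simp add: ip_basis_image)
  also have "\<dots> = ip N (V k) (\<lambda>i. 0)" using kernel[OF j] by (intro ip_cong) auto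
  finally show "ip N (z j) (V k) = 0" using assms by (simp add: ip_simps ip_commute)
qed

text \<open>Equality in Bessel's inequality puts \<open>V k\<close> into the span of the
  \<open>z j\<close>.\<close>

lemma perp_of_span:
  assumes "k < N" "(\<Sum>j<r. (ip N (z j) (V k))\<^sup>2) = 1" "perp v"
  shows "ip N (V k) v = 0"
proof -
  let ?p = "\<lambda>i. \<Sum>j<r. ip N (z j) (V k) * z j i"
  have "ip N (\<lambda>i. V k i - ?p i) (\<lambda>i. V k i - ?p i) = 0"
    using orthonormal_bessel(2)[OF kernel_orthonormal, of "V k"] norm_basis[OF assms(1)] assms(2) by simp
  then have "ip N (V k) v = ip N ?p v"
    by (intro ip_cong) (auto simp: ip_eq_0_iff)
  also have "\<dots> = 0" using assms(3) by (simp add: ip_sum_left ip_simps orth_to_def)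
  finally show ?thesis .
qed

lemma sum_kernel_basis: "j < r \<Longrightarrow> (\<Sum>k<N. (ip N (z j) (V k))\<^sup>2) = 1"
  using orthobasis_parseval[OF basis, of "z j" "z j"] orthonormalD[OF kernel_orthonormal, of j j]
  by (simp add: power2_eq_square ip_commute)

lemma sum_basis_kernel_le: "k < N \<Longrightarrow> (\<Sum>j<r. (ip N (z j) (V k))\<^sup>2) \<le> 1"
  using orthonormal_bessel(1)[OF kernel_orthonormal, of "V k"] norm_basis by simp

text \<open>The last \<open>r\<close> eigenvectors exhaust the kernel: the \<open>r\<close> numbers
  \<open>\<Sum>j<r. (ip N (z j) (V k))\<^sup>2\<close> are at most 1 and add up to \<open>r\<close>.\<close>

lemma quadratic_form_ge_on_perp:
  assumes pos: "eig A (N - r) > 0" and v: "perp v"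
  shows "ip N v (mv A v) \<ge> eig A (N - r) * ip N v v"
proof -
  let ?s = "\<lambda>k. \<Sum>j<r. (ip N (z j) (V k))\<^sup>2"
  have big: "eig A (N - r) \<le> eig A (Suc k)" if "k < N - r" for k
    using decreasing[of k "N - r - 1"] that by (simp add: Suc_diff_Suc)
  have zero: "?s k = 0" if "k < N - r" for k
    using perp_basis[of k] big[OF that] pos that by (simp add: orth_to_def)
  have "(\<Sum>k<N. ?s k) = real r"
    by (subst sum.swap) (simp add: sum_kernel_basis)
  moreover have "(\<Sum>k<N. ?s k) = (\<Sum>k<N - r. ?s k) + (\<Sum>k\<in>{N-r..<N}. ?s k)"
    by (subst sum.union_disjoint[symmetric]) (auto intro!: sum.cong)
  ultimately have tot: "(\<Sum>k\<in>{N-r..<N}. 1 - ?s k) = 0"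
    using zero rank by (simp add: sum_subtractf)
  have one: "?s k = 1" if "N - r \<le> k" "k < N" for k
  proof -
    have "\<forall>k\<in>{N-r..<N}. 1 - ?s k = 0"
      using tot sum_basis_kernel_le by (subst (asm) sum_nonneg_eq_0_iff) auto
    then show ?thesis using that by simp
  qed
  have "ip N v (mv A v) = (\<Sum>k<N. eig A (Suc k) * (ip N (V k) v)\<^sup>2)"
    by (simp add: quadratic_form power2_eq_square mult.assoc)
  \<comment> \<open>The coefficients with \<open>N - r \<le> k\<close> vanish, so only eigenvalues
    that are at least \<open>eig A (N - r)\<close> matter.\<close>
  also have "\<dots> \<ge> (\<Sum>k<N. eig A (N - r) * (ip N (V k) v)\<^sup>2)"
  proof (intro sum_mono)
    fix k assume "k \<in> {..<N}"
    then show "eig A (N - r) * (ip N (V k) v)\<^sup>2 \<le> eig A (Suc k) * (ip N (V k) v)\<^sup>2"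
      using big[of k] perp_of_span[OF _ one v, of k] by (cases "k < N - r") (auto intro: mult_right_mono)
  qed
  also have "(\<Sum>k<N. eig A (N - r) * (ip N (V k) v)\<^sup>2) = eig A (N - r) * ip N v v"
    by (simp add: orthobasis_parseval[OF basis, of v v] power2_eq_square sum_distrib_left)
  finally show ?thesis .
qed

text \<open>Removing the projection onto the kernel vectors leaves the quadratic form unchanged, and
  the squared norm of what remains is the Bessel gap.\<close>

corollary quadratic_form_ge:
  assumes pos: "eig A (N - r) > 0"
  shows "ip N v (mv A v) \<ge> eig A (N - r) * (ip N v v - (\<Sum>j<r. (ip N (z j) v)\<^sup>2))"
proof -
  let ?q = "\<lambda>i. v i - (\<Sum>j<r. ip N (z j) v * z j i)"
  have image: "mv A ?q i = mv A v i" if "i < N" for i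
    using kernel that by (simp add: mv_simps mv_sum)
  have "ip N ?q (mv A ?q) = ip N ?q (mv A v)"
    by (intro ip_cong) (use image in auto)
  also have "\<dots> = ip N (mv A ?q) v"
    by (rule ip_mv_symmetric[OF carrier symmetric])
  also have "\<dots> = ip N v (mv A v)"
    unfolding ip_commute[of N v] by (intro ip_cong) (use image in auto)
  finally show ?thesis
    using quadratic_form_ge_on_perp[OF pos, of ?q] orthonormal_residual[OF kernel_orthonormal]
    by (simp add: orth_to_def orthonormal_bessel(2)[OF kernel_orthonormal])
qed

text \<open>For a zero eigenvalue the residual of \<open>V k\<close> off the span of the
  \<open>z j\<close> is both \<open>perp\<close> and annihilated by \<open>A\<close>, so coercivity
  makes it vanish.\<close>

lemma eig_dichotomy:
  assumes l: "l > 0" and coercive: "\<And>v. perp v \<Longrightarrow> l * ip N v v \<le> ip N v (mv A v)" and k: "k < N"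
  shows "eig A (Suc k) \<ge> l \<and> perp (V k) \<or> eig A (Suc k) = 0 \<and> (\<Sum>j<r. (ip N (z j) (V k))\<^sup>2) = 1"
proof (cases "eig A (Suc k) = 0")
  case False
  have "perp (V k)" by (rule perp_basis[OF k False])
  with coercive[OF this] show ?thesis by (simp add: eig_eq_rayleigh[OF k] norm_basis[OF k])
next
  case True
  let ?p = "\<lambda>i. \<Sum>j<r. ip N (z j) (V k) * z j i"
  let ?q = "\<lambda>i. V k i - ?p i"
  have "perp ?q" using orthonormal_residual[OF kernel_orthonormal] by (simp add: orth_to_def)
  from coercive[OF this] have "l * ip N ?q ?q \<le> ip N ?q (mv A ?q)" .
  also have "\<dots> = ip N ?q (\<lambda>i. 0)"
  proof (intro ip_cong refl)
    fix i assume "i < N"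
    then show "mv A ?q i = 0"
      using True k kernel by (simp add: mv_simps mv_sum eigen)
  qed
  finally have "ip N ?q ?q = 0"
    using l ip_nonneg[of N ?q] by (simp add: ip_simps mult_le_0_iff)
  then show ?thesis
    using True orthonormal_bessel(2)[OF kernel_orthonormal, of "V k"] norm_basis[OF k] by simp
qed

text \<open>Pigeonhole: otherwise each of the last \<open>r + 1\<close> eigenvectors would have a
  projection of squared norm 1 onto the span of the \<open>r\<close> kernel vectors, while these
  squared norms add up to \<open>r\<close> over the whole basis.\<close>

lemma eig_ge_of_coercive:
  assumes l: "l > 0" and coercive: "\<And>v. perp v \<Longrightarrow> l * ip N v v \<le> ip N v (mv A v)"
  shows "eig A (N - r) \<ge> l"
proof (rule ccontr)
  assume neg: "\<not> eig A (N - r) \<ge> l"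
  let ?s = "\<lambda>k. \<Sum>j<r. (ip N (z j) (V k))\<^sup>2"
  have one: "?s k = 1" if "N - r - 1 \<le> k" "k < N" for k
  proof -
    have "eig A (Suc k) \<le> eig A (N - r)"
      using decreasing[OF that] rank by (simp add: Suc_diff_Suc)
    then show ?thesis using eig_dichotomy[OF l coercive that(2)] neg by auto
  qed
  have "real (Suc r) = (\<Sum>k\<in>{N-r-1..<N}. ?s k)"
    using one rank by simp
  also have "\<dots> \<le> (\<Sum>k<N. ?s k)"
    by (intro sum_mono2) (auto intro: sum_nonneg)
  also have "\<dots> = real r"
    by (subst sum.swap) (simp add: sum_kernel_basis)
  finally show False by simp
qed

text \<open>In the eigenbasis the error has the coordinates
  \<open>\<langle>C V\<^sub>k, \<eta>\<rangle> - \<mu> \<langle>M V\<^sub>k, M x\<rangle>\<close> divided by the eigenvalue. The bias part is controlled through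
  \<open>S = \<Sum>\<^sub>k \<langle>M V\<^sub>k, M x\<rangle>\<^sup>2 / \<beta>\<^sub>k = \<langle>M h, M x\<rangle>\<close> with \<open>\<mu> \<parallel>M h\<parallel>\<^sup>2 \<le> S\<close>.\<close>

lemma ridge_error_le:
  fixes \<eta> :: "nat \<Rightarrow> real"
  assumes l: "l > 0" and \<mu>: "\<mu> > 0"
    and coercive: "\<And>v. perp v \<Longrightarrow> l * ip N v v \<le> ip N v (mv A v)"
    and M: "M \<in> carrier_mat R N" and C: "C \<in> carrier_mat Q N"
    and form: "\<And>v w. perp v \<Longrightarrow> perp w \<Longrightarrow>
      ip N v (mv A w) = \<mu> * ip R (mv M v) (mv M w) + ip Q (mv C v) (mv C w)"
    and x: "perp x"
  defines "e \<equiv> \<lambda>i. mv (pinv A) (mv (transpose_mat C) (\<lambda>q. mv C x q + \<eta> q)) i - x i"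
  shows "ip N e e \<le> 2 * \<mu> / l * ip R (mv M x) (mv M x) +
    2 * (\<Sum>k<N. (inverse (eig A (Suc k)))\<^sup>2 * (ip Q (mv C (V k)) \<eta>)\<^sup>2)"
proof -
  define \<kappa> where "\<kappa> = (\<lambda>k. inverse (eig A (Suc k)))"
  define a where "a = (\<lambda>k. ip Q (mv C (V k)) \<eta>)"
  define m where "m = (\<lambda>k. ip R (mv M (V k)) (mv M x))"
  have \<kappa>: "0 \<le> \<kappa> k" "\<kappa> k \<le> 1 / l" if "k < N" for k
  proof -
    have "eig A (Suc k) \<ge> l \<or> eig A (Suc k) = 0" using eig_dichotomy[OF l coercive that] by blast
    then show "0 \<le> \<kappa> k" "\<kappa> k \<le> 1 / l"
      using l by (auto simp: \<kappa>_def inverse_eq_divide frac_le)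
  qed
  \<comment> \<open>The noiseless data \<open>C x\<close> contribute
    \<open>eig A (Suc k) * ip N (V k) x\<close> minus the penalty term, by \<open>form\<close>. For
    a zero eigenvalue everything vanishes, because \<open>x\<close> has no component along
    \<open>V k\<close>.\<close>
  have coord: "ip N (V k) e = \<kappa> k * (a k - \<mu> * m k)" if k: "k < N" for k
  proof -
    have "ip N (V k) (mv (pinv A) f) = \<kappa> k * ip N (V k) f" for f
    proof -
      have "ip N (V k) (mv (pinv A) f) = ip N (V k) (\<lambda>i. \<Sum>l<N. \<kappa> l * ip N (V l) f * V l i)"
        by (intro ip_cong) (auto simp: mv_pinv \<kappa>_def)
      also have "\<dots> = (\<Sum>l<N. \<kappa> l * ip N (V l) f * of_bool (k = l))"
        using k orthonormalD[OF orthobasis_orthonormal[OF basis]]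
        by (auto simp: ip_sum_right ip_simps intro!: sum.cong)
      also have "\<dots> = \<kappa> k * ip N (V k) f"
        using k by (simp add: of_bool_def if_distrib sum.delta cong: if_cong)
      finally show ?thesis .
    qed
    then have 1: "ip N (V k) e = \<kappa> k * (ip Q (mv C (V k)) (mv C x) + a k) - ip N (V k) x"
      unfolding e_def using mv_adjoint[OF C] by (simp add: ip_simps a_def)
    show ?thesis
    proof (cases "eig A (Suc k) = 0")
      case True
      then have "ip N (V k) x = 0"
        using eig_dichotomy[OF l coercive k] l perp_of_span[OF k _ x] by auto
      then show ?thesis using 1 True by (simp add: \<kappa>_def)
    next
      case False
      have "eig A (Suc k) * ip N (V k) x = \<mu> * m k + ip Q (mv C (V k)) (mv C x)"
        using form[OF perp_basis[OF k False] x] ip_basis_image[OF k, of x] by (simp add: m_def)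
      then have "ip N (V k) x = \<kappa> k * (\<mu> * m k + ip Q (mv C (V k)) (mv C x))"
        using False by (simp add: \<kappa>_def field_simps)
      then show ?thesis using 1 by (simp add: algebra_simps)
    qed
  qed
  define S where "S = (\<Sum>k<N. \<kappa> k * (m k)\<^sup>2)"
  define h where "h = (\<lambda>i. \<Sum>k<N. \<kappa> k * m k * V k i)"
  have "perp h"
    unfolding orth_to_def h_def
  proof (intro allI impI)
    fix j assume j: "j < r"
    have "\<kappa> k * m k * ip N (z j) (V k) = 0" if "k < N" for k
      using perp_basis[OF that] j by (cases "eig A (Suc k) = 0") (auto simp: \<kappa>_def orth_to_def)
    then show "ip N (z j) (\<lambda>i. \<Sum>k<N. \<kappa> k * m k * V k i) = 0"
      unfolding ip_sum_right ip_simps by (intro sum.neutral) simp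
  qed
  have S: "S = ip R (mv M h) (mv M x)"
    by (simp add: S_def h_def mv_sum mv_simps ip_sum_left ip_simps m_def power2_eq_square mult.assoc)
  \<comment> \<open>The form of \<open>A\<close> at \<open>h\<close> is exactly \<open>S\<close>,
    since eigenvalue times \<open>(\<kappa> k)\<^sup>2\<close> is \<open>\<kappa> k\<close> even for
    the eigenvalue 0. Dropping its \<open>C\<close> part leaves the penalty.\<close>
  have "\<mu> * ip R (mv M h) (mv M h) \<le> ip N h (mv A h)"
    using form[OF \<open>perp h\<close> \<open>perp h\<close>] by simp
  also have "\<dots> = S"
  proof -
    have "ip N (V k) h = \<kappa> k * m k" if "k < N" for k
    proof -
      have "ip N (V k) h = (\<Sum>l<N. \<kappa> l * m l * of_bool (k = l))"
        unfolding h_def using that orthonormalD[OF orthobasis_orthonormal[OF basis]]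
        by (auto simp: ip_sum_right ip_simps intro!: sum.cong)
      also have "\<dots> = \<kappa> k * m k"
        using that by (simp add: of_bool_def if_distrib sum.delta cong: if_cong)
      finally show ?thesis .
    qed
    then have "ip N h (mv A h) = (\<Sum>k<N. eig A (Suc k) * (\<kappa> k * m k) * (\<kappa> k * m k))"
      by (simp add: quadratic_form)
    also have "\<dots> = S"
      unfolding S_def by (intro sum.cong refl) (auto simp: \<kappa>_def field_simps power2_eq_square)
    finally show ?thesis .
  qed
  finally have hS: "\<mu> * ip R (mv M h) (mv M h) \<le> S" .
  have S0: "S \<ge> 0" unfolding S_def using \<kappa> by (intro sum_nonneg) auto
  have "S\<^sup>2 \<le> ip R (mv M h) (mv M h) * ip R (mv M x) (mv M x)"
    unfolding S by (rule Cauchy_Schwarz_ip)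
  then have "\<mu> * S\<^sup>2 \<le> (\<mu> * ip R (mv M h) (mv M h)) * ip R (mv M x) (mv M x)"
    using \<mu> by (simp add: mult.assoc)
  also have "\<dots> \<le> S * ip R (mv M x) (mv M x)"
    using hS by (intro mult_right_mono) auto
  \<comment> \<open>Cauchy-Schwarz has bounded \<open>S\<^sup>2\<close> by a multiple of
    \<open>S\<close>; one factor is cancelled here.\<close>
  finally have muS: "\<mu> * S \<le> ip R (mv M x) (mv M x)"
    using S0 by (cases "S = 0") (auto simp: power2_eq_square)
  have "ip N e e = (\<Sum>k<N. (ip N (V k) e)\<^sup>2)"
    by (simp add: orthobasis_parseval[OF basis, of e e] power2_eq_square)
  also have "\<dots> = (\<Sum>k<N. (\<kappa> k * a k - \<mu> * (\<kappa> k * m k))\<^sup>2)"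
    using coord by (intro sum.cong refl) (simp add: right_diff_distrib mult_ac)
  also have "\<dots> \<le> (\<Sum>k<N. 2 * ((\<kappa> k)\<^sup>2 * (a k)\<^sup>2) + 2 * \<mu>\<^sup>2 / l * (\<kappa> k * (m k)\<^sup>2))"
  proof (intro sum_mono)
    fix k assume k: "k \<in> {..<N}"
    have "(\<kappa> k * a k - \<mu> * (\<kappa> k * m k))\<^sup>2 \<le> 2 * (\<kappa> k * a k)\<^sup>2 + 2 * (\<mu> * (\<kappa> k * m k))\<^sup>2"
      using zero_le_power2[of "\<kappa> k * a k + \<mu> * (\<kappa> k * m k)"]
      by (simp add: power2_eq_square algebra_simps)
    also have "(\<mu> * (\<kappa> k * m k))\<^sup>2 = \<mu>\<^sup>2 * (\<kappa> k * (\<kappa> k * (m k)\<^sup>2))"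
      by (simp add: power2_eq_square mult_ac)
    \<comment> \<open>Only one of the two factors \<open>\<kappa> k\<close> is replaced by
      \<open>1 / l\<close>; the other is the weight in \<open>S\<close>.\<close>
    also have "\<dots> \<le> \<mu>\<^sup>2 * (1 / l * (\<kappa> k * (m k)\<^sup>2))"
      using \<kappa> k by (intro mult_left_mono mult_right_mono) auto
    finally show "(\<kappa> k * a k - \<mu> * (\<kappa> k * m k))\<^sup>2 \<le> 2 * ((\<kappa> k)\<^sup>2 * (a k)\<^sup>2) + 2 * \<mu>\<^sup>2 / l * (\<kappa> k * (m k)\<^sup>2)"
      by (simp add: power_mult_distrib)
  qed
  also have "\<dots> = 2 * (\<Sum>k<N. (\<kappa> k)\<^sup>2 * (a k)\<^sup>2) + 2 * \<mu> / l * (\<mu> * S)"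
    by (simp add: sum.distrib sum_distrib_left S_def power2_eq_square mult_ac)
  also have "\<dots> \<le> 2 * (\<Sum>k<N. (\<kappa> k)\<^sup>2 * (a k)\<^sup>2) + 2 * \<mu> / l * ip R (mv M x) (mv M x)"
    using muS l \<mu> by (intro add_left_mono mult_left_mono) auto
  finally show ?thesis by (simp add: \<kappa>_def a_def)
qed

end

text \<open>Jensen's inequality for the convex function \<open>s \<mapsto> 1 / s\<^sup>2\<close>, via its tangent at the mean.\<close>

lemma inverse_square_mean_le:
  fixes p \<theta> :: "'i \<Rightarrow> real"
  assumes "finite I" "\<And>i. i \<in> I \<Longrightarrow> p i \<ge> 0" "(\<Sum>i\<in>I. p i) = 1" "\<And>i. i \<in> I \<Longrightarrow> \<theta> i > 0"
    and \<beta>: "2 * \<beta> \<ge> (\<Sum>i\<in>I. p i * \<theta> i)"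
  shows "(inverse \<beta>)\<^sup>2 \<le> 4 * (\<Sum>i\<in>I. p i / (\<theta> i)\<^sup>2)"
proof -
  define a where "a = (\<Sum>i\<in>I. p i * \<theta> i)"
  have "a > 0"
  proof -
    obtain i where "i \<in> I" "p i \<noteq> 0" using assms(3) by (metis sum.neutral zero_neq_one)
    then show ?thesis unfolding a_def using assms by (intro sum_pos2[of _ i]) (auto simp: less_le)
  qed
  \<comment> \<open>After clearing denominators the difference of the two sides is
    \<open>(a - t)\<^sup>2 * (a + 2 * t)\<close>.\<close>
  have tangent: "3 / a\<^sup>2 - 2 * t / a ^ 3 \<le> 1 / t\<^sup>2" if "t > 0" for t
  proof -
    have "0 \<le> (a - t)\<^sup>2 * (a + 2 * t)" using that \<open>a > 0\<close> by simp
    then have "3 * a * t\<^sup>2 - 2 * t ^ 3 \<le> a ^ 3" by (simp add: power2_eq_square power3_eq_cube algebra_simps)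
    then show ?thesis using that \<open>a > 0\<close>
      by (simp add: field_simps power2_eq_square power3_eq_cube)
  qed
  have "1 / a\<^sup>2 = (\<Sum>i\<in>I. p i * (3 / a\<^sup>2 - 2 * \<theta> i / a ^ 3))"
  proof -
    have "(\<Sum>i\<in>I. p i * (3 / a\<^sup>2 - 2 * \<theta> i / a ^ 3)) = 3 / a\<^sup>2 * (\<Sum>i\<in>I. p i) - 2 / a ^ 3 * a"
      unfolding a_def sum_distrib_left sum_subtractf[symmetric] by (intro sum.cong refl) (simp add: algebra_simps)
    then show ?thesis using assms(3) \<open>a > 0\<close> by (simp add: field_simps power2_eq_square power3_eq_cube)
  qed
  also have "\<dots> \<le> (\<Sum>i\<in>I. p i * (1 / (\<theta> i)\<^sup>2))"
    using assms tangent by (intro sum_mono mult_left_mono) auto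
  finally have *: "1 / a\<^sup>2 \<le> (\<Sum>i\<in>I. p i / (\<theta> i)\<^sup>2)" by simp
  \<comment> \<open>The hypothesis gives only \<open>\<beta> \<ge> a / 2\<close>, which costs the
    factor 4.\<close>
  have "(inverse \<beta>)\<^sup>2 \<le> (inverse (a / 2))\<^sup>2"
    using \<beta> \<open>a > 0\<close> unfolding a_def[symmetric] by (intro power_mono le_imp_inverse_le) auto
  also have "\<dots> = 4 * (1 / a\<^sup>2)" by (simp add: power2_eq_square field_simps)
  finally show ?thesis using * by linarith
qed

text \<open>For each \<open>k\<close> the weights sum to 1, so Jensen applies; for each
  \<open>i\<close> they sum to at most 1, which collapses the double sum.\<close>

lemma sum_inverse_square_le:
  fixes p :: "'k \<Rightarrow> 'i \<Rightarrow> real"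
  assumes "finite I" "finite K" "\<And>k i. k \<in> K \<Longrightarrow> i \<in> I \<Longrightarrow> p k i \<ge> 0"
    and "\<And>k. k \<in> K \<Longrightarrow> (\<Sum>i\<in>I. p k i) = 1" "\<And>i. i \<in> I \<Longrightarrow> (\<Sum>k\<in>K. p k i) \<le> 1"
    and "\<And>i. i \<in> I \<Longrightarrow> \<theta> i > 0"
    and "\<And>k. k \<in> K \<Longrightarrow> 2 * \<beta> k \<ge> (\<Sum>i\<in>I. p k i * \<theta> i)"
  shows "(\<Sum>k\<in>K. (inverse (\<beta> k))\<^sup>2) \<le> 4 * (\<Sum>i\<in>I. 1 / (\<theta> i)\<^sup>2)"
proof -
  have "(\<Sum>k\<in>K. (inverse (\<beta> k))\<^sup>2) \<le> (\<Sum>k\<in>K. 4 * (\<Sum>i\<in>I. p k i / (\<theta> i)\<^sup>2))"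
    using assms by (intro sum_mono inverse_square_mean_le) auto
  also have "\<dots> = 4 * (\<Sum>i\<in>I. (\<Sum>k\<in>K. p k i) * (1 / (\<theta> i)\<^sup>2))"
    unfolding sum_distrib_left sum_distrib_right by (subst sum.swap) simp
  also have "\<dots> \<le> 4 * (\<Sum>i\<in>I. 1 * (1 / (\<theta> i)\<^sup>2))"
    using assms by (intro mult_left_mono sum_mono mult_right_mono) auto
  finally show ?thesis by simp
qed

section \<open>Tails of quadratic forms of subgaussian vectors\<close>

lemma nn_integral_normal_density: "\<sigma> > 0 \<Longrightarrow> (\<integral>\<^sup>+g. ennreal (normal_density \<mu> \<sigma> g) \<partial>lborel) = 1"
  by (subst nn_integral_eq_integral) auto

text \<open>Completing the square turns the integrand into a multiple of the normal density centred
  at \<open>b\<close>.\<close>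

lemma gaussian_mgf: "(\<integral>\<^sup>+g. ennreal (std_normal_density g * exp (b * g)) \<partial>lborel) = ennreal (exp (b\<^sup>2 / 2))"
proof -
  have "std_normal_density g * exp (b * g) = exp (b\<^sup>2 / 2) * normal_density b 1 g" for g
    by (simp add: normal_density_def exp_add[symmetric] power2_eq_square algebra_simps diff_divide_distrib add_divide_distrib)
  then have "(\<integral>\<^sup>+g. ennreal (std_normal_density g * exp (b * g)) \<partial>lborel) =
      ennreal (exp (b\<^sup>2 / 2)) * (\<integral>\<^sup>+g. ennreal (normal_density b 1 g) \<partial>lborel)"
    by (simp add: ennreal_mult' nn_integral_cmult)
  then show ?thesis by (simp add: nn_integral_normal_density)
qed

text \<open>The integrand is a multiple of the centred normal density with variance
  \<open>1 / (1 - 2 * c)\<close>, hence the condition on \<open>c\<close>.\<close>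

lemma gaussian_square_mgf:
  assumes "2 * c < 1"
  shows "(\<integral>\<^sup>+g. ennreal (std_normal_density g * exp (c * g\<^sup>2)) \<partial>lborel) = ennreal (1 / sqrt (1 - 2 * c))"
proof -
  define s where "s = 1 / sqrt (1 - 2 * c)"
  have s: "s > 0" "s\<^sup>2 = 1 / (1 - 2 * c)" using assms by (simp_all add: s_def power_divide)
  have "std_normal_density g * exp (c * g\<^sup>2) = s * normal_density 0 s g" for g
  proof -
    have "- g\<^sup>2 / 2 + c * g\<^sup>2 = - g\<^sup>2 / (2 * s\<^sup>2)"
      using assms by (simp add: s(2) field_simps)
    moreover have "1 / sqrt (2 * pi) = s * (1 / sqrt (2 * pi * s\<^sup>2))"
      using s(1) by (simp add: real_sqrt_mult)
    ultimately show ?thesis by (simp add: normal_density_def exp_add[symmetric])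
  qed
  then have "(\<integral>\<^sup>+g. ennreal (std_normal_density g * exp (c * g\<^sup>2)) \<partial>lborel) =
      ennreal s * (\<integral>\<^sup>+g. ennreal (normal_density 0 s g) \<partial>lborel)"
    using s by (simp add: ennreal_mult' nn_integral_cmult)
  then show ?thesis using s by (simp add: nn_integral_normal_density s_def[symmetric])
qed

text \<open>\<open>exp (c X\<^sup>2)\<close> is the moment generating function of an independent Gaussian
  evaluated at \<open>sqrt (2 c) X\<close>.\<close>

lemma subgaussian_square_mgf_le:
  fixes X :: "'a \<Rightarrow> real"
  assumes "prob_space Pr" and X [measurable]: "X \<in> borel_measurable Pr"
    and sub: "\<And>s. (\<integral>\<^sup>+\<omega>. ennreal (exp (s * X \<omega>)) \<partial>Pr) \<le> ennreal (exp (s\<^sup>2 * \<tau> / 2))"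
    and c: "c \<ge> 0" "2 * c * \<tau> < 1"
  shows "(\<integral>\<^sup>+\<omega>. ennreal (exp (c * (X \<omega>)\<^sup>2)) \<partial>Pr) \<le> ennreal (1 / sqrt (1 - 2 * c * \<tau>))"
proof -
  interpret prob_space Pr by fact
  interpret pair_sigma_finite Pr lborel ..
  have "(\<integral>\<^sup>+\<omega>. ennreal (exp (c * (X \<omega>)\<^sup>2)) \<partial>Pr) =
      (\<integral>\<^sup>+\<omega>. (\<integral>\<^sup>+g. ennreal (std_normal_density g * exp (sqrt (2 * c) * X \<omega> * g)) \<partial>lborel) \<partial>Pr)"
    using c by (simp add: gaussian_mgf power_mult_distrib)
  \<comment> \<open>Integrating over \<omega> first makes \<open>sub\<close> applicable at
    \<open>s = sqrt (2 * c) * g\<close>.\<close>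
  also have "\<dots> = (\<integral>\<^sup>+g. (\<integral>\<^sup>+\<omega>. ennreal (std_normal_density g * exp (sqrt (2 * c) * X \<omega> * g)) \<partial>Pr) \<partial>lborel)"
    by (rule Fubini'[symmetric]) measurable
  also have "\<dots> = (\<integral>\<^sup>+g. ennreal (std_normal_density g) *
      (\<integral>\<^sup>+\<omega>. ennreal (exp ((sqrt (2 * c) * g) * X \<omega>)) \<partial>Pr) \<partial>lborel)"
    by (simp add: ennreal_mult' nn_integral_cmult mult_ac)
  also have "\<dots> \<le> (\<integral>\<^sup>+g. ennreal (std_normal_density g) *
      ennreal (exp ((sqrt (2 * c) * g)\<^sup>2 * \<tau> / 2)) \<partial>lborel)"
    by (intro nn_integral_mono mult_left_mono sub) simp
  also have "\<dots> = (\<integral>\<^sup>+g. ennreal (std_normal_density g * exp (c * \<tau> * g\<^sup>2)) \<partial>lborel)"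
    using c by (simp add: ennreal_mult' power_mult_distrib mult_ac)
  also have "\<dots> = ennreal (1 / sqrt (1 - 2 * (c * \<tau>)))"
    using c by (intro gaussian_square_mgf) simp
  finally show ?thesis by (simp add: mult.assoc)
qed

locale subgaussian_vector = prob_space Pr for Pr :: "'a measure" +
  fixes m :: nat and \<tau> :: real and Y :: "'a \<Rightarrow> nat \<Rightarrow> real"
  assumes nonneg: "\<tau> \<ge> 0"
    and measurable_component: "\<And>i. i < m \<Longrightarrow> (\<lambda>\<omega>. Y \<omega> i) \<in> borel_measurable Pr"
    and mgf: "\<And>s u. ip m u u = 1 \<Longrightarrow>
      (\<integral>\<^sup>+\<omega>. ennreal (exp (s * ip m u (Y \<omega>))) \<partial>Pr) \<le> ennreal (exp (s\<^sup>2 * \<tau> / 2))"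
begin

lemma measurable_ip [measurable]: "(\<lambda>\<omega>. ip m u (Y \<omega>)) \<in> borel_measurable Pr"
  unfolding ip_def using measurable_component by measurable

text \<open>With \<open>a k\<close> scaled to a unit vector \<open>u k\<close>, the exponent is an
  average of the terms \<open>c * R * (ip m (u k) (Y \<omega>))\<^sup>2\<close> with weights
  proportional to \<open>ip m (a k) (a k)\<close>. Convexity of \<open>exp\<close> moves the average
  outside, so the dependence between the terms is irrelevant.\<close>

lemma quadratic_mgf_le:
  fixes a :: "nat \<Rightarrow> nat \<Rightarrow> real" and K :: nat
  defines "R \<equiv> \<Sum>k<K. ip m (a k) (a k)"
  assumes R: "R > 0" and c: "c \<ge> 0" "2 * (c * R) * \<tau> < 1"
  shows "(\<integral>\<^sup>+\<omega>. ennreal (exp (c * (\<Sum>k<K. (ip m (a k) (Y \<omega>))\<^sup>2))) \<partial>Pr)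
    \<le> ennreal (1 / sqrt (1 - 2 * (c * R) * \<tau>))"
proof -
  define w where "w = (\<lambda>k. ip m (a k) (a k) / R)"
  \<comment> \<open>For a vanishing \<open>a k\<close> division by zero makes \<open>u k\<close>
    zero instead of a unit vector; its weight \<open>w k\<close> is then 0.\<close>
  define u where "u = (\<lambda>k i. 1 / sqrt (ip m (a k) (a k)) * a k i)"
  have w: "w k \<ge> 0" for k using R by (simp add: w_def)
  have w_sum: "(\<Sum>k<K. w k) = 1" using R by (simp add: w_def R_def sum_divide_distrib[symmetric])
  have K: "K \<noteq> 0" using w_sum by (cases K) auto
  have unit: "ip m (u k) (u k) = 1" if "w k \<noteq> 0" for k
  proof -
    have "ip m (a k) (a k) > 0" using that ip_nonneg[of m "a k"] by (simp add: w_def less_le)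
    then show ?thesis unfolding u_def ip_simps by (simp add: field_simps)
  qed
  have square: "(ip m (a k) f)\<^sup>2 = w k * (R * (ip m (u k) f)\<^sup>2)" for k f
  proof (cases "ip m (a k) (a k) = 0")
    case True
    then show ?thesis using Cauchy_Schwarz_ip[of m "a k" f] by (simp add: w_def)
  next
    case False
    then have "ip m (a k) (a k) > 0" using ip_nonneg[of m "a k"] by (simp add: less_le)
    then show ?thesis using R unfolding u_def ip_simps w_def
      by (simp add: power_mult_distrib power_divide field_simps)
  qed
  have convex: "exp (c * (\<Sum>k<K. (ip m (a k) f)\<^sup>2)) \<le> (\<Sum>k<K. w k * exp ((c * R) * (ip m (u k) f)\<^sup>2))" for f
  proof -
    have "exp (\<Sum>k<K. w k *\<^sub>R ((c * R) * (ip m (u k) f)\<^sup>2)) \<le> (\<Sum>k<K. w k * exp ((c * R) * (ip m (u k) f)\<^sup>2))"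
      using K w w_sum by (intro convex_on_sum[OF _ _ exp_convex]) auto
    then show ?thesis by (simp add: square sum_distrib_left mult_ac)
  qed
  have "(\<integral>\<^sup>+\<omega>. ennreal (exp (c * (\<Sum>k<K. (ip m (a k) (Y \<omega>))\<^sup>2))) \<partial>Pr)
      \<le> (\<integral>\<^sup>+\<omega>. ennreal (\<Sum>k<K. w k * exp ((c * R) * (ip m (u k) (Y \<omega>))\<^sup>2)) \<partial>Pr)"
    using convex by (intro nn_integral_mono ennreal_leI)
  also have "\<dots> = (\<Sum>k<K. ennreal (w k) * (\<integral>\<^sup>+\<omega>. ennreal (exp ((c * R) * (ip m (u k) (Y \<omega>))\<^sup>2)) \<partial>Pr))"
    using w by (simp add: sum_ennreal[symmetric] ennreal_mult' nn_integral_sum nn_integral_cmult)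
  also have "\<dots> \<le> (\<Sum>k<K. ennreal (w k) * ennreal (1 / sqrt (1 - 2 * (c * R) * \<tau>)))"
  proof (intro sum_mono)
    fix k
    show "ennreal (w k) * (\<integral>\<^sup>+\<omega>. ennreal (exp ((c * R) * (ip m (u k) (Y \<omega>))\<^sup>2)) \<partial>Pr)
        \<le> ennreal (w k) * ennreal (1 / sqrt (1 - 2 * (c * R) * \<tau>))"
    proof (cases "w k = 0")
      case False
      show ?thesis
        by (intro mult_left_mono subgaussian_square_mgf_le prob_space_axioms measurable_ip mgf unit False c)
          (use c R in auto)
    qed simp
  qed
  also have "\<dots> = ennreal (1 / sqrt (1 - 2 * (c * R) * \<tau>))"
    using w w_sum by (simp add: sum_distrib_right[symmetric] sum_ennreal)
  finally show ?thesis .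
qed

text \<open>Exponential Markov inequality with \<open>c = 2 / (5 * \<tau> * r)\<close>, where the
  exponential moment is at most \<open>sqrt 5\<close>. On the bad event the exponent is at least
  \<open>2 * t\<close>, and \<open>sqrt 5 * exp (- 2 * t) \<le> exp (- t)\<close> because
  \<open>t > 1\<close>.\<close>

theorem quadratic_tail:
  fixes a :: "nat \<Rightarrow> nat \<Rightarrow> real" and K :: nat
  assumes R: "(\<Sum>k<K. ip m (a k) (a k)) \<le> R" and t: "t > 1"
  shows "prob {\<omega> \<in> space Pr. (\<Sum>k<K. (ip m (a k) (Y \<omega>))\<^sup>2) \<le> 5 * \<tau> * R * t} \<ge> 1 - exp (- t)"
proof -
  define Z where "Z = (\<lambda>\<omega>. \<Sum>k<K. (ip m (a k) (Y \<omega>))\<^sup>2)"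
  have Z [measurable]: "Z \<in> borel_measurable Pr" unfolding Z_def by measurable
  have Z0: "Z \<omega> \<ge> 0" for \<omega> unfolding Z_def by (intro sum_nonneg) auto
  define r where "r = (\<Sum>k<K. ip m (a k) (a k))"
  have r0: "r \<ge> 0" unfolding r_def by (intro sum_nonneg) auto
  have rR: "5 * \<tau> * r * t \<le> 5 * \<tau> * R * t"
    using R nonneg t unfolding r_def by (intro mult_right_mono mult_left_mono) auto
  \<comment> \<open>The choice of \<open>c\<close> divides by \<open>\<tau> * r\<close>. In both
    degenerate cases \<open>Z\<close> vanishes almost surely.\<close>
  have as0: ?thesis if "AE \<omega> in Pr. Z \<omega> = 0"
  proof -
    have bound: "0 \<le> 5 * \<tau> * R * t" using rR r0 nonneg t by (smt (verit) mult_nonneg_nonneg)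
    from that have "AE \<omega> in Pr. Z \<omega> \<le> 5 * \<tau> * R * t"
      by eventually_elim (use bound in simp)
    then have "prob {\<omega> \<in> space Pr. Z \<omega> \<le> 5 * \<tau> * R * t} = 1" by (subst prob_Collect_eq_1) auto
    then show ?thesis by (simp add: Z_def)
  qed
  show ?thesis
  proof (cases "r = 0")
    case True
    then have "ip m (a k) (a k) = 0" if "k < K" for k
      using that by (simp add: r_def sum_nonneg_eq_0_iff)
    then have "(ip m (a k) f)\<^sup>2 = 0" if "k < K" for k f
      using Cauchy_Schwarz_ip[of m "a k" f] that by simp
    then have "Z \<omega> = 0" for \<omega> unfolding Z_def by (intro sum.neutral) simp
    then show ?thesis using as0 by simp
  next
    case False
    with r0 have r: "r > 0" by simp
    note mgf_le = quadratic_mgf_le[of a K, folded r_def Z_def, OF r]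
    have Z_mgf: "(\<integral>\<^sup>+\<omega>. ennreal (exp (c * Z \<omega>)) \<partial>Pr) \<le> ennreal (1 / sqrt (1 - 2 * (c * r) * \<tau>))"
      if "c \<ge> 0" "2 * (c * r) * \<tau> < 1" for c
      using mgf_le[OF that] by (simp add: Z_def)
    show ?thesis
    proof (cases "\<tau> = 0")
      case True
      \<comment> \<open>For \<open>\<tau> = 0\<close> the exponential moment at \<open>c = 1\<close>
        is at most 1, and \<open>1 + Z \<omega> \<le> exp (Z \<omega>)\<close> leaves no room for a
        positive mean of \<open>Z\<close>.\<close>
      have "1 + (\<integral>\<^sup>+\<omega>. ennreal (Z \<omega>) \<partial>Pr) = (\<integral>\<^sup>+\<omega>. ennreal (1 + Z \<omega>) \<partial>Pr)"
        using Z0 by (simp add: ennreal_plus nn_integral_add emeasure_space_1)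
      also have "\<dots> \<le> (\<integral>\<^sup>+\<omega>. ennreal (exp (1 * Z \<omega>)) \<partial>Pr)"
        using Z0 by (intro nn_integral_mono ennreal_leI) (simp add: exp_ge_add_one_self)
      also have "\<dots> \<le> 1" using Z_mgf[of 1] True by simp
      finally have "1 + (\<integral>\<^sup>+\<omega>. ennreal (Z \<omega>) \<partial>Pr) \<le> 1 + 0" by simp
      then have "(\<integral>\<^sup>+\<omega>. ennreal (Z \<omega>) \<partial>Pr) = 0"
        by (simp only: ennreal_add_left_cancel_le) simp
      then have "AE \<omega> in Pr. Z \<omega> = 0"
        using Z0 by (subst (asm) nn_integral_0_iff_AE) (auto simp: ennreal_eq_0_iff antisym)
      then show ?thesis by (rule as0)
    next
      case False
      with nonneg have \<tau>: "\<tau> > 0" by simp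
      define c where "c = 2 / (5 * \<tau> * r)"
      have c: "c > 0" "2 * (c * r) * \<tau> = 4 / 5" using \<tau> r by (simp_all add: c_def)
      define B where "B = {\<omega> \<in> space Pr. 1 \<le> ennreal (exp (- (2 * t))) * ennreal (exp (c * Z \<omega>))}"
      have [measurable]: "B \<in> sets Pr" unfolding B_def by measurable
      have "emeasure Pr B \<le> ennreal (exp (- (2 * t))) * (\<integral>\<^sup>+\<omega>. ennreal (exp (c * Z \<omega>)) * indicator (space Pr) \<omega> \<partial>Pr)"
        unfolding B_def by (rule nn_integral_Markov_inequality) measurable
      also have "(\<integral>\<^sup>+\<omega>. ennreal (exp (c * Z \<omega>)) * indicator (space Pr) \<omega> \<partial>Pr) = (\<integral>\<^sup>+\<omega>. ennreal (exp (c * Z \<omega>)) \<partial>Pr)"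
        by (intro nn_integral_cong) simp
      also have "\<dots> \<le> ennreal (1 / sqrt (1 / 5))" using Z_mgf[of c] c by simp
      finally have "emeasure Pr B \<le> ennreal (exp (- (2 * t)) * sqrt 5)"
        by (simp add: ennreal_mult' real_sqrt_divide mult_left_mono)
      then have "prob B \<le> exp (- (2 * t)) * sqrt 5" by (simp add: emeasure_eq_measure)
      also have "\<dots> \<le> exp (- (2 * t)) * exp t"
      proof (intro mult_left_mono)
        have "5 / 2 \<le> exp (1::real)" using exp_lower_Taylor_quadratic[of "1::real"] by simp
        moreover have "exp (1::real) \<le> exp t" using t by simp
        moreover have "sqrt 5 \<le> 5 / 2" by (rule real_le_lsqrt) (auto simp: power2_eq_square)
        ultimately show "sqrt 5 \<le> exp t" by linarith
      qed simp
      also have "\<dots> = exp (- t)" by (simp add: exp_add[symmetric])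
      finally have "prob B \<le> exp (- t)" .
      moreover have "space Pr - B \<subseteq> {\<omega> \<in> space Pr. Z \<omega> \<le> 5 * \<tau> * R * t}"
      proof
        fix \<omega> assume "\<omega> \<in> space Pr - B"
        then have \<omega>: "\<omega> \<in> space Pr" "\<not> 1 \<le> ennreal (exp (- (2 * t)) * exp (c * Z \<omega>))"
          by (auto simp: B_def ennreal_mult')
        then have "exp (- (2 * t) + c * Z \<omega>) < 1" unfolding exp_add by simp
        then have "c * Z \<omega> < 2 * t" by simp
        then have "Z \<omega> < 5 * \<tau> * r * t" using \<tau> r by (simp add: c_def field_simps)
        with rR \<omega>(1) show "\<omega> \<in> {\<omega> \<in> space Pr. Z \<omega> \<le> 5 * \<tau> * R * t}" by simp
      qed
      then have "prob (space Pr - B) \<le> prob {\<omega> \<in> space Pr. Z \<omega> \<le> 5 * \<tau> * R * t}"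
        by (intro finite_measure_mono) measurable
      ultimately show ?thesis by (simp add: prob_compl Z_def)
    qed
  qed
qed

end

section \<open>Kronecker products, block matrices and incidence matrices\<close>

lemma sum_lessThan_mult:
  fixes f :: "nat \<Rightarrow> 'b :: comm_monoid_add"
  shows "(\<Sum>p<T * n. f p) = (\<Sum>t<T. \<Sum>i<n. f (t * n + i))"
proof (induction T)
  case (Suc T)
  have "(\<Sum>p<Suc T * n. f p) = (\<Sum>p<T * n. f p) + (\<Sum>p\<in>{T * n..<T * n + n}. f p)"
    by (subst sum.union_disjoint[symmetric]) (auto intro!: sum.cong)
  also have "(\<Sum>p\<in>{T * n..<T * n + n}. f p) = (\<Sum>i<n. f (T * n + i))"
    using sum.shift_bounds_nat_ivl[of f 0 "T * n" n] by (simp add: add.commute atLeast0LessThan)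
  finally show ?case using Suc by simp
qed simp

lemma sum_lessThan_add:
  fixes f :: "nat \<Rightarrow> 'b :: comm_monoid_add"
  shows "(\<Sum>p<a + b. f p) = (\<Sum>p<a. f p) + (\<Sum>i<b. f (a + i))"
proof -
  have "(\<Sum>p<a + b. f p) = (\<Sum>p<a. f p) + (\<Sum>p\<in>{a..<a + b}. f p)"
    by (subst sum.union_disjoint[symmetric]) (auto intro!: sum.cong)
  also have "(\<Sum>p\<in>{a..<a + b}. f p) = (\<Sum>i<b. f (a + i))"
    using sum.shift_bounds_nat_ivl[of f 0 a b] by (simp add: add.commute atLeast0LessThan)
  finally show ?thesis .
qed

lemma ip_mult: "ip (T * n) f g = (\<Sum>t<T. ip n (\<lambda>i. f (t * n + i)) (\<lambda>i. g (t * n + i)))"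
  by (simp add: ip_def sum_lessThan_mult)

text \<open>Regroups the index \<open>t * n + i\<close> by the inner coordinate \<open>i\<close>,
  the form in which \<open>L \<otimes> I\<close> acts on each time series.\<close>

lemma ip_mult': "ip (T * n) f g = (\<Sum>i<n. ip T (\<lambda>t. f (t * n + i)) (\<lambda>t. g (t * n + i)))"
  unfolding ip_mult unfolding ip_def by (rule sum.swap)

lemma mult_add_less_mult: "(i :: nat) < a \<Longrightarrow> j < b \<Longrightarrow> i * b + j < a * b"
proof -
  assume "i < a" "j < b"
  then have "i * b + j < Suc i * b" by simp
  also have "\<dots> \<le> a * b" using \<open>i < a\<close> by (intro mult_le_mono1) simp
  finally show ?thesis .
qed

lemma kron_carrier [simp]: "A \<in> carrier_mat a b \<Longrightarrow> B \<in> carrier_mat c d \<Longrightarrow> kron A B \<in> carrier_mat (a * c) (b * d)"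
  by (auto simp: kron_def)

lemma mv_kron:
  assumes "i < dim_row A" "j < dim_row B"
  shows "mv (kron A B) v (i * dim_row B + j) =
    (\<Sum>s<dim_col A. A $$ (i, s) * (\<Sum>l<dim_col B. B $$ (j, l) * v (s * dim_col B + l)))"
proof -
  have "mv (kron A B) v (i * dim_row B + j) =
      (\<Sum>s<dim_col A. \<Sum>l<dim_col B. kron A B $$ (i * dim_row B + j, s * dim_col B + l) * v (s * dim_col B + l))"
    by (simp add: mv_def sum_lessThan_mult kron_def)
  also have "\<dots> = (\<Sum>s<dim_col A. \<Sum>l<dim_col B. A $$ (i, s) * B $$ (j, l) * v (s * dim_col B + l))"
    using assms mult_add_less_mult by (intro sum.cong refl) (auto simp: kron_def)
  finally show ?thesis by (simp add: sum_distrib_left mult_ac)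
qed

lemma block_diag_dim:
  assumes "\<And>t. t < T \<Longrightarrow> A t \<in> carrier_mat (m t) n"
  shows "block_diag T A \<in> carrier_mat (\<Sum>t<T. m t) (T * n)"
  using assms
proof (induction T)
  case (Suc T)
  then have "block_diag T A \<in> carrier_mat (\<Sum>t<T. m t) (T * n)" "A T \<in> carrier_mat (m T) n" by auto
  then show ?case by (auto simp: add.commute)
qed auto

text \<open>Phrased through inner products, so that later uses need no row offsets for blocks of
  different heights.\<close>

lemma ip_block_diag:
  assumes "\<And>t. t < T \<Longrightarrow> A t \<in> carrier_mat (m t) n"
  shows "ip (\<Sum>t<T. m t) (mv (block_diag T A) v) (mv (block_diag T A) w) =
    (\<Sum>t<T. ip (m t) (mv (A t) (\<lambda>i. v (t * n + i))) (mv (A t) (\<lambda>i. w (t * n + i))))"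
  using assms
proof (induction T)
  case 0
  then show ?case by (simp add: ip_def)
next
  case (Suc T)
  let ?Q = "\<Sum>t<T. m t"
  have C: "block_diag T A \<in> carrier_mat ?Q (T * n)" by (rule block_diag_dim) (use Suc.prems in auto)
  have A: "A T \<in> carrier_mat (m T) n" using Suc.prems by auto
  have dim: "dim_col (block_diag (Suc T) A) = T * n + n" using C A by simp
  have top: "mv (block_diag (Suc T) A) f i = mv (block_diag T A) f i" if "i < ?Q" for f i
  proof -
    have "mv (block_diag (Suc T) A) f i =
        (\<Sum>j<T * n. block_diag (Suc T) A $$ (i, j) * f j) + (\<Sum>j<n. block_diag (Suc T) A $$ (i, T * n + j) * f (T * n + j))"
      unfolding mv_def dim by (rule sum_lessThan_add)
    also have "(\<Sum>j<T * n. block_diag (Suc T) A $$ (i, j) * f j) = mv (block_diag T A) f i"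
      unfolding mv_def using C A that by (intro sum.cong) auto
    also have "(\<Sum>j<n. block_diag (Suc T) A $$ (i, T * n + j) * f (T * n + j)) = 0"
      using C A that by (intro sum.neutral) auto
    finally show ?thesis by simp
  qed
  have bot: "mv (block_diag (Suc T) A) f (?Q + i) = mv (A T) (\<lambda>j. f (T * n + j)) i" if "i < m T" for f i
  proof -
    have "mv (block_diag (Suc T) A) f (?Q + i) =
        (\<Sum>j<T * n. block_diag (Suc T) A $$ (?Q + i, j) * f j) + (\<Sum>j<n. block_diag (Suc T) A $$ (?Q + i, T * n + j) * f (T * n + j))"
      unfolding mv_def dim by (rule sum_lessThan_add)
    also have "(\<Sum>j<T * n. block_diag (Suc T) A $$ (?Q + i, j) * f j) = 0"
      using C A that by (intro sum.neutral) auto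
    also have "(\<Sum>j<n. block_diag (Suc T) A $$ (?Q + i, T * n + j) * f (T * n + j)) = mv (A T) (\<lambda>j. f (T * n + j)) i"
      unfolding mv_def using C A that by (intro sum.cong) auto
    finally show ?thesis by simp
  qed
  have "ip (?Q + m T) (mv (block_diag (Suc T) A) v) (mv (block_diag (Suc T) A) w) =
      ip ?Q (mv (block_diag T A) v) (mv (block_diag T A) w) +
      ip (m T) (mv (A T) (\<lambda>i. v (T * n + i))) (mv (A T) (\<lambda>i. w (T * n + i)))"
    unfolding ip_def sum_lessThan_add using top bot by simp
  then show ?case using Suc.IH Suc.prems by simp
qed

lemma stack_vec_index:
  assumes "\<And>t. t < T \<Longrightarrow> v t \<in> carrier_vec n"
  shows "stack_vec T v \<in> carrier_vec (T * n)"
    and "t < T \<Longrightarrow> i < n \<Longrightarrow> stack_vec T v $ (t * n + i) = v t $ i"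
proof -
  have *: "stack_vec T v \<in> carrier_vec (T * n) \<and> (\<forall>t<T. \<forall>i<n. stack_vec T v $ (t * n + i) = v t $ i)"
    using assms
  proof (induction T)
    case (Suc T)
    then have IH: "stack_vec T v \<in> carrier_vec (T * n)" "\<And>t i. t < T \<Longrightarrow> i < n \<Longrightarrow> stack_vec T v $ (t * n + i) = v t $ i"
      and vT: "v T \<in> carrier_vec n" by auto
    have "stack_vec (Suc T) v $ (t * n + i) = v t $ i" if "t < Suc T" "i < n" for t i
    proof (cases "t = T")
      case True
      then show ?thesis using IH(1) vT that by (simp add: append_vec_def Let_def)
    next
      case False
      then have "t * n + i < T * n" using that by (intro mult_add_less_mult) auto
      moreover have "t * n + i < T * n + n" using calculation by simp
      ultimately show ?thesis using IH vT that False by simp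
    qed
    moreover have "stack_vec (Suc T) v \<in> carrier_vec (Suc T * n)"
      using append_carrier_vec[OF IH(1) vT] by (simp add: add.commute)
    ultimately show ?case by blast
  qed auto
  then show "stack_vec T v \<in> carrier_vec (T * n)"
    "t < T \<Longrightarrow> i < n \<Longrightarrow> stack_vec T v $ (t * n + i) = v t $ i" by auto
qed

section \<open>Sums of matrices and incidence matrices\<close>

lemma mat_sum_carrier [simp]: "(\<And>t. t < T \<Longrightarrow> f t \<in> carrier_mat n n) \<Longrightarrow> mat_sum n T f \<in> carrier_mat n n"
  by (induction T) auto

lemma mat_sum_symmetric:
  assumes "\<And>t. t < T \<Longrightarrow> f t \<in> carrier_mat n n" "\<And>t. t < T \<Longrightarrow> transpose_mat (f t) = f t"
  shows "transpose_mat (mat_sum n T f) = mat_sum n T f"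
  using assms by (induction T) (auto simp: transpose_add[of _ n n])

lemma mv_add: "A \<in> carrier_mat R N \<Longrightarrow> B \<in> carrier_mat R N \<Longrightarrow> i < R \<Longrightarrow> mv (A + B) v i = mv A v i + mv B v i"
  by (auto simp: mv_def algebra_simps sum.distrib)

lemma mv_smult: "A \<in> carrier_mat R N \<Longrightarrow> i < R \<Longrightarrow> mv (c \<cdot>\<^sub>m A) v i = c * mv A v i"
  by (auto simp: mv_def sum_distrib_left mult_ac)

lemma mv_mat_sum:
  assumes "\<And>t. t < T \<Longrightarrow> f t \<in> carrier_mat n n" "i < n"
  shows "mv (mat_sum n T f) v i = (\<Sum>t<T. mv (f t) v i)"
  using assms(1)
proof (induction T)
  case 0
  then show ?case using assms(2) by (simp add: mv_def)
next
  case (Suc T)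
  then show ?case using assms(2) by (simp add: mv_add[of _ n n])
qed

lemma inc_mat_carrier [simp]: "inc_mat N es \<in> carrier_mat (length es) N"
  by (simp add: inc_mat_def)

text \<open>Each row has one entry 1 and one entry -1; that they do not coincide is the absence of
  loops.\<close>

lemma mv_inc_mat_const:
  assumes "simple_oriented_graph N es" "k < length es"
  shows "mv (inc_mat N es) (\<lambda>_. c) k = 0"
proof -
  obtain a b where e: "es ! k = (a, b)" by (cases "es ! k")
  then have ab: "a < N" "b < N" "a \<noteq> b"
    using assms nth_mem[OF assms(2)] by (auto simp: simple_oriented_graph_def)
  have "mv (inc_mat N es) (\<lambda>_. c) k = (\<Sum>v<N. (if v = a then c else 0) - (if v = b then c else 0))"
    unfolding mv_def using assms(2) e ab by (intro sum.cong) (auto simp: inc_mat_def)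
  also have "\<dots> = 0" using ab by (simp add: sum_subtractf)
  finally show ?thesis .
qed

section \<open>Euclidean norm and operator norm\<close>

lemma vnorm_square: "(vnorm v)\<^sup>2 = ip (dim_vec v) (($) v) (($) v)"
  by (simp add: vnorm_def ip_def power2_eq_square[symmetric] sum_nonneg)

lemma vnorm_nonneg: "vnorm v \<ge> 0"
  by (simp add: vnorm_def sum_nonneg)

lemma op_norm2_bound:
  assumes A: "A \<in> carrier_mat R N"
  shows "ip R (mv A v) (mv A v) \<le> (op_norm2 A)\<^sup>2 * ip N v v" and "op_norm2 A \<ge> 0"
proof -
  let ?S = "{vnorm (A *\<^sub>v v) | v. v \<in> carrier_vec (dim_col A) \<and> vnorm v \<le> 1}"
  have norm_mv: "(vnorm (A *\<^sub>v v))\<^sup>2 = ip R (mv A (($) v)) (mv A (($) v))" if "v \<in> carrier_vec N" for v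
    unfolding vnorm_square using A that by (auto intro!: ip_cong mv_index)
  \<comment> \<open>The squared Frobenius norm. It bounds the set, which has to be known before the
    real \<open>Sup\<close> can be used as an upper bound.\<close>
  define F where "F = (\<Sum>i<R. ip N (\<lambda>j. A $$ (i, j)) (\<lambda>j. A $$ (i, j)))"
  have bdd: "bdd_above ?S"
  proof (rule bdd_aboveI[of _ "sqrt F"])
    fix y assume "y \<in> ?S"
    then obtain v where v: "v \<in> carrier_vec N" "vnorm v \<le> 1" "y = vnorm (A *\<^sub>v v)" using A by auto
    have v1: "ip N (($) v) (($) v) \<le> 1"
      using v(1,2) vnorm_square[of v] power_le_one[OF vnorm_nonneg[of v], of 2] by simp
    have "y\<^sup>2 = (\<Sum>i<R. (ip N (\<lambda>j. A $$ (i, j)) (($) v))\<^sup>2)"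
      using A v norm_mv by (simp add: ip_def[of R] mv_def ip_def[of N] power2_eq_square)
    also have "\<dots> \<le> (\<Sum>i<R. ip N (\<lambda>j. A $$ (i, j)) (\<lambda>j. A $$ (i, j)) * ip N (($) v) (($) v))"
      by (intro sum_mono Cauchy_Schwarz_ip)
    also have "\<dots> \<le> (\<Sum>i<R. ip N (\<lambda>j. A $$ (i, j)) (\<lambda>j. A $$ (i, j)) * 1)"
      using v1 by (intro sum_mono mult_left_mono) auto
    finally have "y\<^sup>2 \<le> F" by (simp add: F_def)
    then show "y \<le> sqrt F" by (rule real_le_rsqrt)
  qed
  have mem: "0 \<in> ?S"
  proof -
    have "vnorm (A *\<^sub>v 0\<^sub>v N) = 0" "vnorm (0\<^sub>v N :: real vec) \<le> 1"
      using A by (auto simp: vnorm_def)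
    then show ?thesis using A by (auto intro!: exI[of _ "0\<^sub>v N"])
  qed
  show nonneg: "op_norm2 A \<ge> 0"
    unfolding op_norm2_def by (rule cSup_upper[OF mem bdd])
  show "ip R (mv A v) (mv A v) \<le> (op_norm2 A)\<^sup>2 * ip N v v"
  proof (cases "ip N v v = 0")
    case True
    then have "mv A v i = 0" for i
      using A by (auto simp: mv_def ip_eq_0_iff)
    then show ?thesis using True by (simp add: ip_def)
  next
    case False
    define c where "c = sqrt (ip N v v)"
    have c: "c > 0" "c\<^sup>2 = ip N v v" using False ip_nonneg[of N v] by (auto simp: c_def less_le)
    define u where "u = Matrix.vec N (\<lambda>i. 1 / c * v i)"
    have u: "u \<in> carrier_vec N" by (simp add: u_def)
    have "(vnorm u)\<^sup>2 = ip N (\<lambda>i. 1 / c * v i) (\<lambda>i. 1 / c * v i)"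
      unfolding vnorm_square by (simp add: u_def) (intro ip_cong, auto simp: u_def)
    also have "\<dots> = 1" using c False unfolding ip_simps by (simp add: power2_eq_square)
    finally have "vnorm u \<le> 1" using vnorm_nonneg[of u] by (simp add: power2_eq_1_iff)
    then have "vnorm (A *\<^sub>v u) \<in> ?S" using A u by auto
    then have "vnorm (A *\<^sub>v u) \<le> op_norm2 A" unfolding op_norm2_def using bdd by (rule cSup_upper)
    then have "(vnorm (A *\<^sub>v u))\<^sup>2 \<le> (op_norm2 A)\<^sup>2"
      using vnorm_nonneg by (intro power_mono)
    moreover have "(vnorm (A *\<^sub>v u))\<^sup>2 = (1 / c)\<^sup>2 * ip R (mv A v) (mv A v)"
    proof -
      have image: "mv A (($) u) = (\<lambda>i. 1 / c * mv A v i)"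
        unfolding mv_simps(3)[symmetric] using A by (intro mv_cong) (auto simp: u_def)
      show ?thesis unfolding norm_mv[OF u] image ip_simps by (simp add: power2_eq_square)
    qed
    moreover have "ip N v v > 0" using False ip_nonneg[of N v] by (simp add: less_le)
    ultimately show ?thesis using c(2) by (simp add: power_divide pos_divide_le_eq)
  qed
qed

section \<open>The lower bound on the eigenvalue\<close>

text \<open>The second branch is half the smaller eigenvalue of the symmetric 2 by 2 matrix with
  diagonal \<open>b2\<close>, \<open>\<mu> * b1\<close> and off-diagonal entry
  \<open>- b3 / 2\<close>.\<close>

lemma lam_bar'_otherwise:
  assumes "b3 > 0" "\<not> \<mu> * b1 < b2 + (b3\<^sup>2 - b2\<^sup>2) / (2 * b2)"
  shows "lam_bar' b1 b2 b3 \<mu> = (\<mu> * b1 + b2 - sqrt (b3\<^sup>2 + (\<mu> * b1 - b2)\<^sup>2)) / 4"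
proof -
  define d where "d = \<mu> * b1 - b2"
  define s where "s = sqrt (b3\<^sup>2 + d\<^sup>2)"
  have s: "s > 0" "s * s = b3 * b3 + d * d"
    using assms(1) by (auto simp: s_def add_pos_nonneg power2_eq_square[symmetric])
  have m: "\<mu> * b1 = d + b2" by (simp add: d_def)
  have "lam_bar' b1 b2 b3 \<mu> = 1/4 * (1 - d / s) * (d + b2) + b2 / 4 + (b2 * d - b3\<^sup>2) / (4 * s)"
    using assms(2) by (simp add: lam_bar'_def d_def s_def)
  also have "\<dots> = (s * (d + 2 * b2) - (b3 * b3 + d * d)) / (4 * s)"
    using s(1) by (simp add: field_simps power2_eq_square)
  also have "\<dots> = (d + 2 * b2 - s) / 4"
    unfolding s(2)[symmetric] using s(1) by (simp add: field_simps)
  finally show ?thesis by (simp add: d_def s_def)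
qed

lemma lam_bar'_threshold:
  assumes "b2 > (0::real)"
  shows "m < b2 + (b3\<^sup>2 - b2\<^sup>2) / (2 * b2) \<longleftrightarrow> 2 * b2 * m < b2\<^sup>2 + b3\<^sup>2"
  using assms by (simp add: field_simps power2_eq_square)

text \<open>Above the threshold \<open>4 * b2 * m > b3\<^sup>2\<close> with
  \<open>m = \<mu> * b1\<close>, so the 2 by 2 matrix behind \<open>lam_bar'_otherwise\<close> has
  positive determinant.\<close>

lemma lam_bar'_pos:
  assumes "b1 > 0" "b2 > 0" "b3 > 0" "\<mu> > 0"
  shows "lam_bar' b1 b2 b3 \<mu> > 0"
proof (cases "\<mu> * b1 < b2 + (b3\<^sup>2 - b2\<^sup>2) / (2 * b2)")
  case True
  then show ?thesis using assms by (simp add: lam_bar'_def add_pos_nonneg)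
next
  case False
  define m where "m = \<mu> * b1"
  have m: "m > 0" using assms by (simp add: m_def)
  have "b2\<^sup>2 + b3\<^sup>2 \<le> 2 * b2 * m"
    using False lam_bar'_threshold[of b2 m b3] assms by (simp add: m_def)
  moreover have "b2\<^sup>2 > 0" "b3\<^sup>2 > 0" using assms by simp_all
  moreover have "b3\<^sup>2 + (m - b2)\<^sup>2 = (m + b2)\<^sup>2 + b3\<^sup>2 - 4 * (b2 * m)"
    by (simp add: power2_eq_square algebra_simps)
  ultimately have "b3\<^sup>2 + (m - b2)\<^sup>2 < (m + b2)\<^sup>2" by linarith
  then have "sqrt (b3\<^sup>2 + (m - b2)\<^sup>2) < m + b2"
    using m assms by (intro real_less_lsqrt) auto
  then show ?thesis using lam_bar'_otherwise[OF assms(3) False] by (simp add: m_def)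
qed

text \<open>With \<open>m = \<mu> * b1\<close> the last hypothesis reads
  \<open>b2 * m \<ge> b2\<^sup>2 + b3\<^sup>2\<close>. This selects the second branch and makes the
  root there at most \<open>m\<close>.\<close>

lemma lam_bar'_ge:
  assumes "b2 > 0" "b3 > 0" "\<mu> * b1 \<ge> b2 + b3\<^sup>2 / b2"
  shows "lam_bar' b1 b2 b3 \<mu> \<ge> b2 / 4"
proof -
  define m where "m = \<mu> * b1"
  have m: "b2 * m \<ge> b2\<^sup>2 + b3\<^sup>2"
    using assms by (simp add: m_def field_simps power2_eq_square)
  have "m \<ge> 0" using assms by (smt (verit) divide_nonneg_pos m_def zero_le_power2)
  have sq: "b2\<^sup>2 \<ge> 0" "b3\<^sup>2 \<ge> 0" by simp_all
  have "2 * b2 * m \<ge> b2\<^sup>2 + b3\<^sup>2" using m sq by linarith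
  then have other: "\<not> \<mu> * b1 < b2 + (b3\<^sup>2 - b2\<^sup>2) / (2 * b2)"
    using lam_bar'_threshold[OF assms(1), of m b3] by (simp add: m_def)
  have "b3\<^sup>2 + (m - b2)\<^sup>2 = m\<^sup>2 + b2\<^sup>2 + b3\<^sup>2 - 2 * (b2 * m)"
    by (simp add: power2_eq_square algebra_simps)
  then have "b3\<^sup>2 + (m - b2)\<^sup>2 \<le> m\<^sup>2" using m sq by linarith
  then have "sqrt (b3\<^sup>2 + (m - b2)\<^sup>2) \<le> m"
    using \<open>m \<ge> 0\<close> by (intro real_le_lsqrt) auto
  then show ?thesis using lam_bar'_otherwise[OF assms(2) other] by (simp add: m_def)
qed

text \<open>In both cases \<open>2 * lam_bar'\<close> is a lower bound on the unit circle for
  \<open>\<mu> b\<^sub>1 b\<^sup>2 + max 0 (b\<^sub>2 a\<^sup>2 - b\<^sub>3 a b)\<close>: above the threshold it is the smallest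
  eigenvalue of the quadratic form, below it is the value at the kink \<open>b\<^sub>2 a = b\<^sub>3 b\<close>.\<close>

lemma lam_bar'_quadratic_form:
  assumes pos: "b1 > 0" "b2 > 0" "b3 > 0" "\<mu> > 0" and ab: "a \<ge> 0" "b \<ge> 0"
    and G: "G \<ge> 0" "G \<ge> b2 * a\<^sup>2 - b3 * a * b"
  shows "2 * lam_bar' b1 b2 b3 \<mu> * (a\<^sup>2 + b\<^sup>2) \<le> \<mu> * b1 * b\<^sup>2 + G"
proof -
  define m where "m = \<mu> * b1"
  have m: "m > 0" using pos by (simp add: m_def)
  show ?thesis
  proof (cases "\<mu> * b1 < b2 + (b3\<^sup>2 - b2\<^sup>2) / (2 * b2)")
    case True
    define q where "q = b2\<^sup>2 + b3\<^sup>2"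
    have q: "q > 0" using pos by (simp add: q_def add_pos_nonneg)
    have mq: "2 * b2 * m < q" using True lam_bar'_threshold[OF pos(2), of m b3] by (simp add: m_def q_def)
    have lam: "2 * lam_bar' b1 b2 b3 \<mu> = b2\<^sup>2 * m / q"
    proof -
      have "lam_bar' b1 b2 b3 \<mu> = b2\<^sup>2 / (2 * q) * m"
        using True by (simp add: lam_bar'_def m_def q_def)
      then show ?thesis by simp
    qed
    have "b2\<^sup>2 * m * (a\<^sup>2 + b\<^sup>2) \<le> q * (m * b\<^sup>2 + G)"
    proof (cases "b2 * a \<le> b3 * b")
      case True
      then have "(b2 * a)\<^sup>2 \<le> (b3 * b)\<^sup>2" using pos ab by (intro power_mono) auto
      then have "b2\<^sup>2 * (a\<^sup>2 + b\<^sup>2) \<le> q * b\<^sup>2" by (simp add: q_def power_mult_distrib algebra_simps)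
      then have "m * (b2\<^sup>2 * (a\<^sup>2 + b\<^sup>2)) \<le> m * (q * b\<^sup>2)" using m by (intro mult_left_mono) auto
      moreover have "q * G \<ge> 0" using q G by simp
      ultimately show ?thesis by (simp add: algebra_simps)
    next
      case False
      have "m * (b2 * a + b3 * b) \<le> m * (2 * b2 * a)"
        using False m by (intro mult_left_mono) linarith+
      also have "\<dots> = 2 * b2 * m * a" by simp
      also have "\<dots> \<le> q * a" using mq ab by (intro mult_right_mono) auto
      \<comment> \<open>The difference of the two sides, with \<open>G\<close> at its lower bound,
        factors; the second factor is nonnegative because \<open>2 * b2 * m < q\<close>.\<close>
      finally have "0 \<le> (b2 * a - b3 * b) * (q * a - m * (b2 * a + b3 * b))"
        using False by (intro mult_nonneg_nonneg) auto
      also have "\<dots> = q * (m * b\<^sup>2 + (b2 * a\<^sup>2 - b3 * a * b)) - b2\<^sup>2 * m * (a\<^sup>2 + b\<^sup>2)"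
        by (simp add: q_def power2_eq_square algebra_simps)
      also have "\<dots> \<le> q * (m * b\<^sup>2 + G) - b2\<^sup>2 * m * (a\<^sup>2 + b\<^sup>2)"
        using G q by simp
      finally show ?thesis by simp
    qed
    then show ?thesis using q unfolding lam m_def[symmetric] by (simp add: field_simps)
  next
    case False
    define d where "d = m - b2"
    define s where "s = sqrt (b3\<^sup>2 + d\<^sup>2)"
    have s: "s \<ge> 0" "s\<^sup>2 = b3\<^sup>2 + d\<^sup>2" by (simp_all add: s_def)
    \<comment> \<open>The inner product of \<open>(d, - b3)\<close>, of length \<open>s\<close>,
      with \<open>(b\<^sup>2 - a\<^sup>2, 2 * a * b)\<close>, of length
      \<open>a\<^sup>2 + b\<^sup>2\<close>. The next equation is Lagrange's identity for this
      pair.\<close>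
    define X where "X = d * (b\<^sup>2 - a\<^sup>2) - b3 * (2 * a * b)"
    have "X\<^sup>2 + (d * (2 * a * b) + b3 * (b\<^sup>2 - a\<^sup>2))\<^sup>2 = s\<^sup>2 * (a\<^sup>2 + b\<^sup>2)\<^sup>2"
      unfolding s(2) by (simp add: X_def power2_eq_square algebra_simps)
    then have "X\<^sup>2 \<le> (s * (a\<^sup>2 + b\<^sup>2))\<^sup>2"
      using zero_le_power2[of "d * (2 * a * b) + b3 * (b\<^sup>2 - a\<^sup>2)"]
      unfolding power_mult_distrib by linarith
    then have "\<bar>X\<bar> \<le> s * (a\<^sup>2 + b\<^sup>2)"
      using s(1) abs_le_square_iff[of X "s * (a\<^sup>2 + b\<^sup>2)"] by simp
    then have X: "X + s * (a\<^sup>2 + b\<^sup>2) \<ge> 0" by linarith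
    have "2 * lam_bar' b1 b2 b3 \<mu> * (a\<^sup>2 + b\<^sup>2) = (m + b2 - s) / 2 * (a\<^sup>2 + b\<^sup>2)"
      using lam_bar'_otherwise[OF pos(3) False] by (simp add: m_def d_def s_def)
    also have "\<dots> \<le> m * b\<^sup>2 + (b2 * a\<^sup>2 - b3 * a * b)"
      using X by (simp add: X_def d_def field_simps)
    also have "\<dots> \<le> m * b\<^sup>2 + G" using G by simp
    finally show ?thesis by (simp add: m_def)
  qed
qed

section \<open>Synchronization over a dynamic network\<close>

lemma inc_mat_dim [simp]: "dim_row (inc_mat N es) = length es" "dim_col (inc_mat N es) = N"
  by (simp_all add: inc_mat_def)

lemma inc_mat_gram_carrier [simp]: "transpose_mat (inc_mat N es) * inc_mat N es \<in> carrier_mat N N"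
  by auto

lemma mv_laplacian_const:
  assumes "simple_oriented_graph N es" "p < N"
  shows "mv (transpose_mat (inc_mat N es) * inc_mat N es) (\<lambda>_. c) p = 0"
proof -
  have "mv (transpose_mat (inc_mat N es) * inc_mat N es) (\<lambda>_. c) p =
      mv (transpose_mat (inc_mat N es)) (mv (inc_mat N es) (\<lambda>_. c)) p"
    using assms(2) by (intro mv_mult[of _ N "length es" _ N]) auto
  also have "mv (transpose_mat (inc_mat N es)) (mv (inc_mat N es) (\<lambda>_. c)) =
      mv (transpose_mat (inc_mat N es)) (\<lambda>_. 0)"
    by (intro mv_cong) (simp add: mv_inc_mat_const[OF assms(1)])
  finally show ?thesis by (simp add: mv_def)
qed

lemma transpose_smult_mat: "transpose_mat (c \<cdot>\<^sub>m A) = c \<cdot>\<^sub>m transpose_mat (A :: real mat)"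
  by (intro eq_matI) auto

lemma gram_symmetric: "A \<in> carrier_mat a b \<Longrightarrow> transpose_mat (transpose_mat A * A) = transpose_mat A * (A :: real mat)"
  by (simp add: transpose_mult[of _ b a _ b])

text \<open>Collects the deterministic data only; spectral gaps and noise enter as hypotheses of
  single lemmas.\<close>

locale dynamic_network =
  fixes n T :: nat and es :: "(nat \<times> nat) list" and est :: "nat \<Rightarrow> (nat \<times> nat) list" and \<mu> :: real
  assumes n: "n \<ge> 2" and T: "T \<ge> 2"
    and graph: "simple_oriented_graph T es"
    and graphs: "t < T \<Longrightarrow> simple_oriented_graph n (est t)"
    and \<mu>: "\<mu> > 0"
begin

definition L :: "real mat" where "L = transpose_mat (inc_mat T es) * inc_mat T es"
definition M :: "real mat" where "M = kron (inc_mat T es) (1\<^sub>m n)"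
definition C :: "real mat" where "C = block_diag T (\<lambda>t. inc_mat n (est t))"
definition OTO :: "real mat" where
  "OTO = mat_sum n T (\<lambda>t. transpose_mat (inc_mat n (est t)) * inc_mat n (est t))"
definition P :: "real mat" where
  "P = kron (1\<^sub>m T) (1\<^sub>m n - (1 / real n) \<cdot>\<^sub>m mat n n (\<lambda>_. 1))"
definition H :: "real mat" where "H = \<mu> \<cdot>\<^sub>m (transpose_mat M * M) + transpose_mat C * C"
definition B :: "real mat" where "B = P * H * P"

abbreviation N :: nat where "N \<equiv> T * n"
abbreviation R :: nat where "R \<equiv> length es * n"
abbreviation Q :: nat where "Q \<equiv> \<Sum>t<T. length (est t)"

text \<open>Coordinate \<open>p\<close> belongs to time \<open>p div n\<close>, so these are the
  normalized indicators of the time blocks, an orthonormal basis of the kernel of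
  \<open>P\<close>.\<close>

definition z :: "nat \<Rightarrow> nat \<Rightarrow> real" where
  "z t p = (if p div n = t then 1 / sqrt (real n) else 0)"

text \<open>The values at node \<open>i\<close> over time.\<close>

definition slice :: "nat \<Rightarrow> (nat \<Rightarrow> real) \<Rightarrow> nat \<Rightarrow> real" where
  "slice i v t = v (t * n + i)"

text \<open>The bilinear form of \<open>H\<close>. On vectors with zero sum in every time block it
  is also that of \<open>B\<close>, so the estimates can be made without \<open>P\<close>.\<close>

definition energy :: "(nat \<Rightarrow> real) \<Rightarrow> (nat \<Rightarrow> real) \<Rightarrow> real" where
  "energy v w = \<mu> * ip R (mv M v) (mv M w) + ip Q (mv C v) (mv C w)"

section \<open>Matrices and quadratic forms of the network\<close>

lemma L_carrier: "L \<in> carrier_mat T T"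
  by (auto simp: L_def)

lemma L_symmetric: "transpose_mat L = L"
  unfolding L_def by (rule gram_symmetric[OF inc_mat_carrier])

lemma M_carrier: "M \<in> carrier_mat R N"
  unfolding M_def by (rule kron_carrier) auto

lemma C_carrier: "C \<in> carrier_mat Q N"
  unfolding C_def by (rule block_diag_dim) simp

lemma OTO_carrier: "OTO \<in> carrier_mat n n"
  unfolding OTO_def by (rule mat_sum_carrier) auto

lemma OTO_symmetric: "transpose_mat OTO = OTO"
  unfolding OTO_def by (rule mat_sum_symmetric) (auto intro!: gram_symmetric)

lemma P_carrier: "P \<in> carrier_mat N N"
  unfolding P_def by (rule kron_carrier) auto

lemma P_symmetric: "transpose_mat P = P"
  by (rule eq_matI) (use n in \<open>auto simp: P_def kron_def less_mult_imp_div_less\<close>)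

lemma H_carrier: "H \<in> carrier_mat N N"
  using M_carrier C_carrier by (auto simp: H_def)

lemma H_symmetric: "transpose_mat H = H"
  unfolding H_def using M_carrier C_carrier gram_symmetric[OF M_carrier] gram_symmetric[OF C_carrier]
  by (simp add: transpose_add[of _ N N] transpose_smult_mat)

lemma B_carrier: "B \<in> carrier_mat N N"
  using P_carrier H_carrier by (auto simp: B_def)

lemma B_symmetric: "transpose_mat B = B"
  using P_carrier H_carrier P_symmetric H_symmetric
  by (simp add: B_def transpose_mult[of _ N N _ N] assoc_mult_mat[of _ N N _ N _ N])

text \<open>This is \<open>M\<^sup>T M = L \<otimes> I\<close>: one copy of the Laplacian for each
  node.\<close>

lemma ip_M: "ip R (mv M v) (mv M w) = (\<Sum>i<n. ip T (slice i v) (mv L (slice i w)))"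
proof -
  have entry: "mv M f (k * n + i) = mv (inc_mat T es) (slice i f) k" if "k < length es" "i < n" for f k i
  proof -
    have "mv M f (k * n + i) = (\<Sum>s<T. inc_mat T es $$ (k, s) * (\<Sum>l<n. 1\<^sub>m n $$ (i, l) * f (s * n + l)))"
      using mv_kron[of k "inc_mat T es" i "1\<^sub>m n" f] that by (simp add: M_def)
    also have "(\<lambda>s. \<Sum>l<n. 1\<^sub>m n $$ (i, l) * f (s * n + l)) = slice i f"
    proof
      fix s
      have "(\<Sum>l<n. 1\<^sub>m n $$ (i, l) * f (s * n + l)) = (\<Sum>l<n. if l = i then f (s * n + l) else 0)"
        using that by (intro sum.cong) auto
      then show "(\<Sum>l<n. 1\<^sub>m n $$ (i, l) * f (s * n + l)) = slice i f s"
        using that by (simp add: slice_def)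
    qed
    finally show ?thesis by (simp add: mv_def inc_mat_def)
  qed
  show ?thesis
    unfolding ip_mult' L_def ip_mv_gram[OF inc_mat_carrier]
    by (intro sum.cong refl ip_cong) (auto simp: entry)
qed

lemma ip_C: "ip Q (mv C v) (mv C w) = (\<Sum>t<T. ip (length (est t))
    (mv (inc_mat n (est t)) (\<lambda>i. v (t * n + i))) (mv (inc_mat n (est t)) (\<lambda>i. w (t * n + i))))"
  unfolding C_def by (rule ip_block_diag) simp

lemma ip_OTO: "ip n u (mv OTO w) =
    (\<Sum>t<T. ip (length (est t)) (mv (inc_mat n (est t)) u) (mv (inc_mat n (est t)) w))"
proof -
  have "ip n u (mv OTO w) = ip n u (\<lambda>i. \<Sum>t<T. mv (transpose_mat (inc_mat n (est t)) * inc_mat n (est t)) w i)"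
    unfolding OTO_def by (intro ip_cong refl mv_mat_sum) auto
  then show ?thesis by (simp add: ip_sum_right ip_mv_gram[OF inc_mat_carrier])
qed

lemma z_index: "i < n \<Longrightarrow> z t (s * n + i) = (if s = t then 1 / sqrt (real n) else 0)"
  by (simp add: z_def)

lemma ip_z: "t < T \<Longrightarrow> ip N (z t) v = (\<Sum>i<n. v (t * n + i)) / sqrt (real n)"
proof -
  assume t: "t < T"
  have "ip N (z t) v = (\<Sum>s<T. if s = t then (\<Sum>i<n. v (s * n + i)) / sqrt (real n) else 0)"
    unfolding ip_mult unfolding ip_def by (intro sum.cong) (auto simp: z_index sum_divide_distrib)
  then show ?thesis using t by simp
qed

lemma orthonormal_z: "orthonormal N T z"
  unfolding orthonormal_def
proof (intro allI impI)
  fix s t assume "s < T" "t < T"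
  then show "ip N (z s) (z t) = of_bool (s = t)"
    using n by (simp add: ip_z z_index)
qed

text \<open>Orthogonality to the \<open>z t\<close> describes the range of \<open>P\<close> and
  matches the zero-sum hypothesis on each signal \<open>xt t\<close>.\<close>

lemma orth_to_z: "orth_to N T z v \<longleftrightarrow> (\<forall>t<T. (\<Sum>i<n. v (t * n + i)) = 0)"
  using n by (auto simp: orth_to_def ip_z)

lemma mv_P:
  assumes "t < T" "i < n"
  shows "mv P v (t * n + i) = v (t * n + i) - (\<Sum>l<n. v (t * n + l)) / real n"
proof -
  let ?\<Pi> = "1\<^sub>m n - (1 / real n) \<cdot>\<^sub>m mat n n (\<lambda>_. 1) :: real mat"
  have "mv P v (t * n + i) = (\<Sum>s<T. 1\<^sub>m T $$ (t, s) * (\<Sum>l<n. ?\<Pi> $$ (i, l) * v (s * n + l)))"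
    using mv_kron[of t "1\<^sub>m T" i ?\<Pi> v] assms by (simp add: P_def)
  also have "\<dots> = (\<Sum>s<T. if s = t then (\<Sum>l<n. ?\<Pi> $$ (i, l) * v (s * n + l)) else 0)"
    using assms by (intro sum.cong) auto
  also have "\<dots> = (\<Sum>l<n. ?\<Pi> $$ (i, l) * v (t * n + l))"
    using assms by simp
  also have "\<dots> = (\<Sum>l<n. (if l = i then v (t * n + l) else 0) - v (t * n + l) / real n)"
    using assms by (intro sum.cong) (auto simp: field_simps)
  also have "\<dots> = v (t * n + i) - (\<Sum>l<n. v (t * n + l)) / real n"
    using assms by (simp add: sum_subtractf sum_divide_distrib)
  finally show ?thesis .
qed

lemma index_split:
  assumes "p < N"
  obtains t i where "t < T" "i < n" "p = t * n + i"
  using assms n that[of "p div n" "p mod n"] by (simp add: less_mult_imp_div_less)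

lemma mv_P_orth: "orth_to N T z v \<Longrightarrow> p < N \<Longrightarrow> mv P v p = v p"
  by (erule index_split) (simp add: mv_P orth_to_z)

lemma mv_P_z: "t < T \<Longrightarrow> p < N \<Longrightarrow> mv P (z t) p = 0"
  using n by (elim index_split) (simp add: mv_P z_index)

lemma mv_B: "p < N \<Longrightarrow> mv B v p = mv P (mv H (mv P v)) p"
proof -
  assume p: "p < N"
  have "mv B v p = mv (P * H) (mv P v) p"
    unfolding B_def using P_carrier H_carrier p by (intro mv_mult[of _ N N]) auto
  also have "\<dots> = mv P (mv H (mv P v)) p"
    using P_carrier H_carrier p by (intro mv_mult[of _ N N]) auto
  finally show ?thesis .
qed

lemma mv_B_z: "t < T \<Longrightarrow> p < N \<Longrightarrow> mv B (z t) p = 0"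
proof -
  assume "t < T" "p < N"
  have "mv H (mv P (z t)) = (\<lambda>_. 0)"
    using mv_P_z[OF \<open>t < T\<close>] H_carrier by (auto simp: mv_def)
  then show ?thesis using \<open>p < N\<close> by (simp add: mv_B) (simp add: mv_def)
qed

lemma ip_H: "ip N v (mv H w) = energy v w"
proof -
  have "ip N v (mv H w) = ip N v (\<lambda>i. \<mu> * mv (transpose_mat M * M) w i + mv (transpose_mat C * C) w i)"
    unfolding H_def using M_carrier C_carrier
    by (intro ip_cong refl) (simp add: mv_add[of _ N N] mv_smult[of _ N N])
  then show ?thesis
    by (simp add: ip_simps energy_def ip_mv_gram[OF M_carrier] ip_mv_gram[OF C_carrier])
qed

lemma ip_B:
  assumes "orth_to N T z v" "orth_to N T z w"
  shows "ip N v (mv B w) = energy v w"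
proof -
  have "ip N v (mv B w) = ip N v (mv P (mv H (mv P w)))"
    by (intro ip_cong) (auto simp: mv_B)
  also have "\<dots> = ip N (mv P v) (mv H (mv P w))"
    by (rule ip_mv_symmetric[OF P_carrier P_symmetric])
  also have "\<dots> = ip N v (mv H (mv P w))"
    using assms by (intro ip_cong) (auto simp: mv_P_orth)
  also have "mv H (mv P w) = mv H w"
    using assms H_carrier by (intro mv_cong) (auto simp: mv_P_orth)
  finally show ?thesis by (simp add: ip_H)
qed

lemma mv_inc_mat_block_z:
  assumes "t < T" "k < length (est t)"
  shows "mv (inc_mat n (est t)) (\<lambda>i. z s (t * n + i)) k = 0"
proof -
  have "mv (inc_mat n (est t)) (\<lambda>i. z s (t * n + i)) =
      mv (inc_mat n (est t)) (\<lambda>_. if t = s then 1 / sqrt (real n) else 0)"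
    by (intro mv_cong) (auto simp: z_index inc_mat_def)
  then show ?thesis using mv_inc_mat_const[OF graphs[OF assms(1)] assms(2)] by simp
qed

lemma mv_gram_C_z:
  assumes "s < T" "p < N"
  shows "mv (transpose_mat C * C) (z s) p = 0"
proof -
  have "ip Q (mv C (z s)) (mv C (z s)) = 0"
    unfolding ip_C by (intro sum.neutral ballI) (auto simp: ip_eq_0_iff mv_inc_mat_block_z)
  then have "mv C (z s) q = 0" if "q < Q" for q using that by (simp add: ip_eq_0_iff)
  then have "mv (transpose_mat C) (mv C (z s)) p = 0"
    using C_carrier by (auto simp: mv_def)
  then show ?thesis using C_carrier assms(2) by (subst mv_mult[of _ N Q _ N]) auto
qed

lemma T_less_N: "T < N"
proof -
  have "T * 1 < T * n" using n T by (intro mult_strict_left_mono) auto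
  then show ?thesis by simp
qed

text \<open>Identifies the index of the statement as the last one before the \<open>T\<close> kernel
  directions.\<close>

lemma N_minus_T: "N - T = T * (n - 1)"
  by (simp add: diff_mult_distrib2)

section \<open>Eigenbases with their known kernel vectors\<close>

lemma eigenbasis_B:
  obtains V where "eigenbasis_with_kernel B N V T z"
proof -
  obtain V where "symmetric_eigenbasis B N V" using spectral_theorem[OF B_carrier B_symmetric] .
  then have "eigenbasis_with_kernel B N V T z"
    using orthonormal_z mv_B_z T_less_N
    by (simp add: eigenbasis_with_kernel_def eigenbasis_with_kernel_axioms_def)
  then show ?thesis by (rule that)
qed

lemma eigenbasis_gram_C:
  obtains V where "eigenbasis_with_kernel (transpose_mat C * C) N V T z"
proof -
  have "transpose_mat C * C \<in> carrier_mat N N" using C_carrier by auto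
  then obtain V where "symmetric_eigenbasis (transpose_mat C * C) N V"
    using spectral_theorem gram_symmetric[OF C_carrier] by metis
  then have "eigenbasis_with_kernel (transpose_mat C * C) N V T z"
    using orthonormal_z mv_gram_C_z T_less_N
    by (simp add: eigenbasis_with_kernel_def eigenbasis_with_kernel_axioms_def)
  then show ?thesis by (rule that)
qed

text \<open>There is one kernel vector, the normalized constant, so \<open>eig L (T - 1)\<close>
  governs the complement of the constants.\<close>

lemma eigenbasis_L:
  obtains U where "eigenbasis_with_kernel L T U 1 (\<lambda>_ _. 1 / sqrt (real T))"
proof -
  obtain U where U: "symmetric_eigenbasis L T U" using spectral_theorem[OF L_carrier L_symmetric] .
  have "orthonormal T 1 (\<lambda>_ _. 1 / sqrt (real T))"
    using T by (simp add: orthonormal_def ip_def)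
  moreover have "mv L (\<lambda>_. 1 / sqrt (real T)) p = 0" if "p < T" for p
    unfolding L_def using graph that by (rule mv_laplacian_const)
  ultimately have "eigenbasis_with_kernel L T U 1 (\<lambda>_ _. 1 / sqrt (real T))"
    using U T by (simp add: eigenbasis_with_kernel_def eigenbasis_with_kernel_axioms_def)
  then show ?thesis by (rule that)
qed

lemma eigenbasis_OTO:
  obtains U where "eigenbasis_with_kernel OTO n U 1 (\<lambda>_ _. 1 / sqrt (real n))"
proof -
  obtain U where U: "symmetric_eigenbasis OTO n U" using spectral_theorem[OF OTO_carrier OTO_symmetric] .
  have "orthonormal n 1 (\<lambda>_ _. 1 / sqrt (real n))"
    using n by (simp add: orthonormal_def ip_def)
  moreover have "mv OTO (\<lambda>_. 1 / sqrt (real n)) p = 0" if "p < n" for p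
  proof -
    have "mv OTO (\<lambda>_. 1 / sqrt (real n)) p =
        (\<Sum>t<T. mv (transpose_mat (inc_mat n (est t)) * inc_mat n (est t)) (\<lambda>_. 1 / sqrt (real n)) p)"
      unfolding OTO_def using that by (intro mv_mat_sum) auto
    also have "\<dots> = 0"
      using graphs that by (intro sum.neutral ballI mv_laplacian_const) auto
    finally show ?thesis .
  qed
  ultimately have "eigenbasis_with_kernel OTO n U 1 (\<lambda>_ _. 1 / sqrt (real n))"
    using U n by (simp add: eigenbasis_with_kernel_def eigenbasis_with_kernel_axioms_def)
  then show ?thesis by (rule that)
qed

section \<open>Lower bounds on the energy\<close>

lemma L_nonneg: "ip T c (mv L c) \<ge> 0"
  unfolding L_def ip_mv_gram[OF inc_mat_carrier] by simp

text \<open>Split \<open>v\<close> into \<open>vb\<close>, constant in time, and \<open>w\<close>.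
  The gap of \<open>L\<close> in each slice bounds the penalty below by
  \<open>b1 * ip N w w\<close>. In \<open>C v\<close> the part of \<open>vb\<close> is the form of
  \<open>OTO\<close> divided by \<open>T\<close>, and twice the cross term is at least
  \<open>- b3\<close> times the two norms. \<open>lam_bar'_quadratic_form\<close> combines
  these.\<close>

lemma energy_ge:
  assumes b: "b1 > 0" "b2 > 0" "b3 > 0"
    and L_ge: "eig L (T - 1) \<ge> b1" and OTO_ge: "eig OTO (n - 1) / real T \<ge> b2"
    and cross: "2 * op_norm2 C * sqrt (eig OTO 1) / sqrt (real T) \<le> b3"
    and v: "orth_to N T z v"
  shows "2 * lam_bar' b1 b2 b3 \<mu> * ip N v v \<le> energy v v"
proof -
  have T0: "real T > 0" using T by simp
  \<comment> \<open>The time average multiplied by \<open>sqrt (real T)\<close>; this scaling gives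
    \<open>vb\<close> the same norm as \<open>u\<close>.\<close>
  define u where "u = (\<lambda>i. (\<Sum>t<T. v (t * n + i)) / sqrt (real T))"
  define vb where "vb = (\<lambda>p. u (p mod n) / sqrt (real T))"
  define w where "w = (\<lambda>p. v p - vb p)"
  have vb: "vb (t * n + i) = 1 / sqrt (real T) * u i" if "i < n" for t i
    using that by (simp add: vb_def)
  have vb_vb: "ip N vb vb = ip n u u"
    unfolding ip_mult' using T0 by (simp add: ip_def vb power2_eq_square[symmetric] power_divide)
  have vb_v: "ip N vb v = ip n u u"
  proof -
    have "ip T (\<lambda>t. vb (t * n + i)) (\<lambda>t. v (t * n + i)) = u i * u i" if "i < n" for i
      using that by (simp add: ip_def vb sum_divide_distrib[symmetric] sum_distrib_left[symmetric])
        (simp add: u_def)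
    then show ?thesis unfolding ip_mult' by (simp add: ip_def[of n])
  qed
  have w_w: "ip N w w = ip N v v - ip n u u"
    using vb_vb vb_v by (simp add: w_def ip_simps ip_commute[of N v vb])
  obtain U where U: "eigenbasis_with_kernel L T U 1 (\<lambda>_ _. 1 / sqrt (real T))"
    by (rule eigenbasis_L)
  interpret L: eigenbasis_with_kernel L T U 1 "\<lambda>_ _. 1 / sqrt (real T)" by (rule U)
  have M_ge: "ip R (mv M v) (mv M v) \<ge> b1 * ip N w w"
  proof -
    have "b1 * (ip T (slice i v) (slice i v) - (u i)\<^sup>2) \<le> ip T (slice i v) (mv L (slice i v))" for i
    proof -
      have u_i: "ip T (\<lambda>_. 1 / sqrt (real T)) (slice i v) = u i"
        by (simp add: ip_def u_def slice_def sum_divide_distrib)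
      have "0 \<le> ip T (slice i v) (slice i v) - (u i)\<^sup>2"
        using orthonormal_bessel(1)[OF L.kernel_orthonormal, of "slice i v"] by (simp add: u_i)
      then have "b1 * (ip T (slice i v) (slice i v) - (u i)\<^sup>2) \<le> eig L (T - 1) * (ip T (slice i v) (slice i v) - (u i)\<^sup>2)"
        using L_ge by (intro mult_right_mono) auto
      also have "\<dots> \<le> ip T (slice i v) (mv L (slice i v))"
        using L.quadratic_form_ge[of "slice i v"] L_ge b by (simp add: u_i)
      finally show ?thesis .
    qed
    then have "(\<Sum>i<n. b1 * (ip T (slice i v) (slice i v) - (u i)\<^sup>2)) \<le> ip R (mv M v) (mv M v)"
      unfolding ip_M by (intro sum_mono)
    moreover have "ip N v v = (\<Sum>i<n. ip T (slice i v) (slice i v))"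
      unfolding ip_mult' slice_def[abs_def] ..
    ultimately show ?thesis
      unfolding w_w by (simp add: sum_distrib_left[symmetric] sum_subtractf ip_def[of n] power2_eq_square)
  qed
  obtain W where W: "eigenbasis_with_kernel OTO n W 1 (\<lambda>_ _. 1 / sqrt (real n))"
    by (rule eigenbasis_OTO)
  interpret O: eigenbasis_with_kernel OTO n W 1 "\<lambda>_ _. 1 / sqrt (real n)" by (rule W)
  have OTO_ge': "eig OTO (n - 1) \<ge> b2 * real T" using OTO_ge T0 by (simp add: pos_le_divide_eq)
  then have OTO_pos: "eig OTO (n - 1) > 0" using b T0 by (smt (verit) mult_pos_pos)
  have OTO_1: "eig OTO 1 \<ge> 0"
    using O.decreasing[of 0 "n - 2"] n OTO_pos by (simp add: numeral_2_eq_2 Suc_diff_Suc)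
  define cc where "cc = ip Q (mv C vb) (mv C vb)"
  have cc: "cc = ip n u (mv OTO u) / real T"
  proof -
    have "mv (inc_mat n (est t)) (\<lambda>i. vb (t * n + i)) = (\<lambda>i. 1 / sqrt (real T) * mv (inc_mat n (est t)) u i)" for t
      unfolding mv_simps(3)[symmetric] by (intro mv_cong) (simp add: vb)
    then have "cc = (\<Sum>t<T. 1 / sqrt (real T) * (1 / sqrt (real T) *
        ip (length (est t)) (mv (inc_mat n (est t)) u) (mv (inc_mat n (est t)) u)))"
      unfolding cc_def ip_C by (simp only: ip_simps)
    then show ?thesis
      using T0 by (simp add: ip_OTO sum_divide_distrib)
  qed
  \<comment> \<open>An average of zero-sum blocks has zero sum, so \<open>u\<close> is orthogonal to
    the constants and the eigenvalue of \<open>OTO\<close> with index \<open>n - 1\<close>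
    applies.\<close>
  have sum_u: "(\<Sum>i<n. u i) = 0"
  proof -
    have "(\<Sum>i<n. u i) = (\<Sum>t<T. \<Sum>i<n. v (t * n + i)) / sqrt (real T)"
      unfolding u_def sum_divide_distrib[symmetric] by (subst sum.swap) simp
    then show ?thesis using v by (simp add: orth_to_z)
  qed
  have "orth_to n 1 (\<lambda>_ _. 1 / sqrt (real n)) u"
    using sum_u by (simp add: orth_to_def ip_def sum_divide_distrib[symmetric])
  then have "eig OTO (n - 1) * ip n u u \<le> ip n u (mv OTO u)"
    using O.quadratic_form_ge_on_perp OTO_pos by simp
  then have "b2 * real T * ip n u u \<le> ip n u (mv OTO u)"
    using mult_right_mono[OF OTO_ge' ip_nonneg[of n u]] by linarith
  then have cc_ge: "b2 * ip n u u \<le> cc" using T0 by (simp add: cc pos_le_divide_eq mult_ac)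
  have cc_le: "cc \<le> eig OTO 1 / real T * ip n u u"
    using O.quadratic_form_le[of u] n T0 by (simp add: cc divide_right_mono)
  define a where "a = sqrt (ip n u u)"
  define b where "b = sqrt (ip N w w)"
  have ab: "a \<ge> 0" "b \<ge> 0" "a\<^sup>2 = ip n u u" "b\<^sup>2 = ip N w w" by (simp_all add: a_def b_def)
  define c where "c = op_norm2 C"
  have c: "c \<ge> 0" and Cw: "ip Q (mv C w) (mv C w) \<le> c\<^sup>2 * ip N w w"
    using op_norm2_bound[OF C_carrier] by (simp_all add: c_def)
  define X where "X = ip Q (mv C vb) (mv C w)"
  \<comment> \<open>Cauchy-Schwarz bounds \<open>X\<close> by \<open>g * (a * b)\<close> in absolute
    value, and \<open>cross\<close> says \<open>2 * g \<le> b3\<close>.\<close>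
  define g where "g = c * sqrt (eig OTO 1) / sqrt (real T)"
  have g: "0 \<le> g" "g \<le> b3 / 2" "g\<^sup>2 = c\<^sup>2 * (eig OTO 1 / real T)"
  proof -
    have "2 * g = 2 * op_norm2 C * sqrt (eig OTO 1) / sqrt (real T)" by (simp add: g_def c_def)
    with cross show "g \<le> b3 / 2" by linarith
    show "0 \<le> g" unfolding g_def using c OTO_1 by (intro divide_nonneg_nonneg mult_nonneg_nonneg) auto
    show "g\<^sup>2 = c\<^sup>2 * (eig OTO 1 / real T)"
      unfolding g_def power_divide power_mult_distrib using OTO_1 T0 by simp
  qed
  have "X\<^sup>2 \<le> cc * ip Q (mv C w) (mv C w)" unfolding X_def cc_def by (rule Cauchy_Schwarz_ip)
  moreover have "cc * ip Q (mv C w) (mv C w) \<le> (eig OTO 1 / real T * a\<^sup>2) * (c\<^sup>2 * b\<^sup>2)"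
    unfolding ab using cc_le Cw OTO_1 by (intro mult_mono) auto
  moreover have "(eig OTO 1 / real T * a\<^sup>2) * (c\<^sup>2 * b\<^sup>2) = (g * (a * b))\<^sup>2"
    unfolding power_mult_distrib g(3) by simp
  moreover have "(g * (a * b))\<^sup>2 \<le> (b3 / 2 * (a * b))\<^sup>2"
    using g ab by (intro power_mono mult_right_mono mult_nonneg_nonneg) auto
  ultimately have "X\<^sup>2 \<le> (b3 / 2 * (a * b))\<^sup>2" by linarith
  then have "\<bar>X\<bar> \<le> \<bar>b3 / 2 * (a * b)\<bar>" by (simp only: abs_le_square_iff)
  then have X: "2 * X \<ge> - (b3 * a * b)" using b ab by (simp add: abs_mult)
  have "ip Q (mv C v) (mv C v) = cc + 2 * X + ip Q (mv C w) (mv C w)"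
  proof -
    have "v = (\<lambda>p. vb p + w p)" by (simp add: w_def)
    then have "mv C v = (\<lambda>p. mv C vb p + mv C w p)" by (metis mv_simps(1))
    then show ?thesis by (simp add: ip_simps cc_def X_def ip_commute[of Q "mv C w" "mv C vb"])
  qed
  then have G: "ip Q (mv C v) (mv C v) \<ge> b2 * a\<^sup>2 - b3 * a * b"
    using cc_ge X ip_nonneg[of Q "mv C w"] unfolding ab by linarith
  have "2 * lam_bar' b1 b2 b3 \<mu> * (a\<^sup>2 + b\<^sup>2) \<le> \<mu> * b1 * b\<^sup>2 + ip Q (mv C v) (mv C v)"
    using assms(1-3) \<mu> ab(1,2) _ G by (rule lam_bar'_quadratic_form) simp
  also have "\<mu> * b1 * b\<^sup>2 \<le> \<mu> * ip R (mv M v) (mv M v)"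
    using M_ge \<mu> ab by (simp add: mult.assoc)
  finally show ?thesis unfolding ab w_w by (simp add: energy_def)
qed

text \<open>Serves the other branch of the maximum in \<open>lbar\<close>: the penalty is dropped,
  and a nonpositive eigenvalue makes the bound trivial.\<close>

lemma energy_ge_gram_C:
  assumes "orth_to N T z v"
  shows "eig (transpose_mat C * C) (T * (n - 1)) * ip N v v \<le> energy v v"
proof -
  obtain V where V: "eigenbasis_with_kernel (transpose_mat C * C) N V T z" by (rule eigenbasis_gram_C)
  interpret G: eigenbasis_with_kernel "transpose_mat C * C" N V T z by (rule V)
  have M: "0 \<le> \<mu> * ip R (mv M v) (mv M v)" using \<mu> by simp
  show ?thesis
  proof (cases "eig (transpose_mat C * C) (T * (n - 1)) > 0")
    case True
    then show ?thesis
      using G.quadratic_form_ge_on_perp[of v] assms M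
      by (simp add: N_minus_T energy_def ip_mv_gram[OF C_carrier])
  next
    case False
    then have "eig (transpose_mat C * C) (T * (n - 1)) * ip N v v \<le> 0"
      by (simp add: mult_nonpos_nonneg)
    also have "0 \<le> energy v v" using \<mu> by (simp add: energy_def)
    finally show ?thesis .
  qed
qed

text \<open>On the complement of the kernel, twice the regularized Gram matrix dominates
  \<open>l + \<mu> (L \<otimes> I)\<close>. The weights are the squared coordinates of the
  eigenvectors of \<open>B\<close> in the eigenbasis \<open>U\<^sub>t \<otimes> e\<^sub>i\<close> of \<open>L \<otimes> I\<close>.\<close>

lemma sum_inverse_eig_square_le:
  assumes V: "eigenbasis_with_kernel B N V T z" and l: "l > 0"
    and coercive: "\<And>v. orth_to N T z v \<Longrightarrow> l * ip N v v \<le> energy v v"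
  shows "(\<Sum>k<N. (inverse (eig B (Suc k)))\<^sup>2) \<le>
    4 * real n * ((\<Sum>t = 1..T - 1. 1 / (l + \<mu> * eig L t)\<^sup>2) + 1 / l\<^sup>2)"
proof -
  interpret B: eigenbasis_with_kernel B N V T z by (rule V)
  obtain U where U: "eigenbasis_with_kernel L T U 1 (\<lambda>_ _. 1 / sqrt (real T))"
    by (rule eigenbasis_L)
  interpret L: eigenbasis_with_kernel L T U 1 "\<lambda>_ _. 1 / sqrt (real T)" by (rule U)
  have L_eig: "eig L (Suc t) \<ge> 0" if "t < T" for t
    using L.eig_eq_rayleigh[OF that] L_nonneg by simp
  define \<theta> where "\<theta> = (\<lambda>q :: nat \<times> nat. l + \<mu> * eig L (Suc (fst q)))"
  define p where "p = (\<lambda>k q. (ip T (U (fst q)) (slice (snd q) (V k)))\<^sup>2)"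
  \<comment> \<open>Zero eigenvalues contribute \<open>inverse 0 = 0\<close> to the sum; the
    remaining eigenvectors are orthogonal to all \<open>z t\<close>.\<close>
  define K where "K = {k. k < N \<and> eig B (Suc k) \<noteq> 0}"
  let ?I = "{..<T} \<times> {..<n}"
  have total: "(\<Sum>q\<in>?I. p k q) = ip N (V k) (V k)" for k
  proof -
    have "(\<Sum>q\<in>?I. p k q) = (\<Sum>i<n. \<Sum>t<T. (ip T (U t) (slice i (V k)))\<^sup>2)"
      unfolding p_def by (subst sum.swap) (simp add: sum.cartesian_product case_prod_unfold)
    also have "\<dots> = (\<Sum>i<n. ip T (slice i (V k)) (slice i (V k)))"
      by (simp add: orthobasis_parseval[OF L.basis, of "slice _ (V k)" "slice _ (V k)"] power2_eq_square)
    finally show ?thesis by (simp add: ip_mult' slice_def[abs_def])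
  qed
  have "(\<Sum>k\<in>K. (inverse (eig B (Suc k)))\<^sup>2) \<le> 4 * (\<Sum>q\<in>?I. 1 / (\<theta> q)\<^sup>2)"
  proof (rule sum_inverse_square_le[where p = p])
    show "(\<Sum>q\<in>?I. p k q) = 1" if "k \<in> K" for k
      using that total B.norm_basis by (simp add: K_def)
    show "(\<Sum>k\<in>K. p k q) \<le> 1" if q_mem: "q \<in> ?I" for q
    proof -
      obtain t i where q: "q = (t, i)" "t < T" "i < n" using q_mem by auto
      \<comment> \<open>The vector \<open>U t \<otimes> e i\<close>. By Parseval in the basis
        \<open>V\<close> its squared coordinates add up to its squared norm, which is 1.\<close>
      define g where "g = (\<lambda>r. if r mod n = i then U t (r div n) else 0)"
      have g: "ip N g f = ip T (U t) (slice i f)" for f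
      proof -
        have "ip N g f = (\<Sum>s<T. \<Sum>j<n. if j = i then U t s * f (s * n + j) else 0)"
          unfolding ip_mult unfolding ip_def by (intro sum.cong) (auto simp: g_def)
        then show ?thesis using q by (simp add: ip_def slice_def)
      qed
      have "(\<Sum>k\<in>K. p k q) \<le> (\<Sum>k<N. p k q)"
        by (intro sum_mono2) (auto simp: K_def p_def)
      also have "\<dots> = ip N g g"
        unfolding orthobasis_parseval[OF B.basis, of g g] ip_commute[of N "V _" g]
        by (simp add: g p_def q power2_eq_square)
      also have "\<dots> = ip T (U t) (U t)"
        unfolding g using q by (intro ip_cong) (auto simp: slice_def g_def)
      also have "\<dots> = 1" using q L.norm_basis by simp
      finally show ?thesis .
    qed
    show "\<theta> q > 0" if "q \<in> ?I" for q
      using that l \<mu> L_eig by (auto simp: \<theta>_def intro!: add_pos_nonneg)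
    \<comment> \<open>The left side is \<open>l\<close> plus the penalty of \<open>V k\<close>. Each
      of the two is at most the energy of \<open>V k\<close>, which is the eigenvalue, hence the
      factor 2.\<close>
    show "(\<Sum>q\<in>?I. p k q * \<theta> q) \<le> 2 * eig B (Suc k)" if "k \<in> K" for k
    proof -
      have k: "k < N" "orth_to N T z (V k)" using that B.perp_basis by (auto simp: K_def)
      have split: "(\<Sum>q\<in>?I. p k q * \<theta> q) = l * (\<Sum>q\<in>?I. p k q) + \<mu> * (\<Sum>q\<in>?I. p k q * eig L (Suc (fst q)))"
        unfolding sum_distrib_left sum.distrib[symmetric]
        by (intro sum.cong refl) (simp add: \<theta>_def algebra_simps)
      have "(\<Sum>q\<in>?I. p k q * eig L (Suc (fst q))) =
          (\<Sum>i<n. \<Sum>t<T. (ip T (U t) (slice i (V k)))\<^sup>2 * eig L (Suc t))"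
        unfolding p_def by (subst sum.swap) (simp add: sum.cartesian_product case_prod_unfold)
      also have "\<dots> = ip R (mv M (V k)) (mv M (V k))"
        unfolding ip_M L.quadratic_form by (simp add: power2_eq_square mult_ac)
      finally have "(\<Sum>q\<in>?I. p k q * \<theta> q) = l * ip N (V k) (V k) + \<mu> * ip R (mv M (V k)) (mv M (V k))"
        unfolding split total by simp
      moreover have "energy (V k) (V k) = eig B (Suc k)"
        using B.eig_eq_rayleigh[OF k(1)] ip_B[OF k(2) k(2)] by simp
      ultimately show ?thesis
        using coercive[OF k(2)] ip_nonneg[of Q "mv C (V k)"] unfolding energy_def by linarith
    qed
  qed (auto simp: K_def p_def)
  moreover have "(\<Sum>k\<in>K. (inverse (eig B (Suc k)))\<^sup>2) = (\<Sum>k<N. (inverse (eig B (Suc k)))\<^sup>2)"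
    by (intro sum.mono_neutral_left) (auto simp: K_def)
  moreover have "(\<Sum>q\<in>?I. 1 / (\<theta> q)\<^sup>2) = real n * (\<Sum>t<T. 1 / (l + \<mu> * eig L (Suc t))\<^sup>2)"
  proof -
    have "(\<Sum>q\<in>?I. 1 / (\<theta> q)\<^sup>2) = (\<Sum>t<T. \<Sum>i<n. 1 / (l + \<mu> * eig L (Suc t))\<^sup>2)"
      unfolding \<theta>_def sum.cartesian_product by (simp add: case_prod_unfold)
    then show ?thesis by (simp add: sum_distrib_left)
  qed
  moreover have "(\<Sum>t<T. 1 / (l + \<mu> * eig L (Suc t))\<^sup>2) =
      (\<Sum>t = 1..T - 1. 1 / (l + \<mu> * eig L t)\<^sup>2) + 1 / (l + \<mu> * eig L T)\<^sup>2"
  proof -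
    obtain m where "T = Suc m" using T by (cases T) auto
    then show ?thesis by (simp add: sum.atLeast1_atMost_eq)
  qed
  \<comment> \<open>The last Laplacian eigenvalue supplies the separate summand
    \<open>1 / l\<^sup>2\<close>.\<close>
  moreover have "1 / (l + \<mu> * eig L T)\<^sup>2 \<le> 1 / l\<^sup>2"
    using l \<mu> L_eig[of "T - 1"] T by (intro frac_le power_mono) auto
  then have "4 * (real n * (1 / (l + \<mu> * eig L T)\<^sup>2)) \<le> 4 * (real n * (1 / l\<^sup>2))"
    by (intro mult_left_mono) auto
  ultimately show ?thesis by (simp add: algebra_simps)
qed

section \<open>Error of the estimator\<close>

lemma estimation_error_measurable:
  assumes "subgaussian_vector Pr Q \<tau> Y"
  shows "(\<lambda>\<omega>. mv (pinv B) (mv (transpose_mat C) (\<lambda>q. mv C x q + Y \<omega> q)) i - x i) \<in> borel_measurable Pr"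
proof -
  interpret subgaussian_vector Pr Q \<tau> Y by fact
  have dim: "dim_col (transpose_mat C) = Q" using C_carrier by simp
  show ?thesis
    unfolding mv_def[of "pinv B"] mv_def[of "transpose_mat C"] dim
    using measurable_component by measurable
qed

lemma estimation_error:
  fixes Pr :: "'a measure" and Y :: "'a \<Rightarrow> nat \<Rightarrow> real" and \<tau> :: real
  assumes Y: "subgaussian_vector Pr Q \<tau> Y" and l: "l > 0"
    and coercive: "\<And>v. orth_to N T z v \<Longrightarrow> l * ip N v v \<le> energy v v"
    and x: "orth_to N T z x" and t: "t > 1"
  defines "e \<equiv> \<lambda>\<omega> i. mv (pinv B) (mv (transpose_mat C) (\<lambda>q. mv C x q + Y \<omega> q)) i - x i"
  shows "Sigma_Algebra.measure Pr {\<omega> \<in> space Pr. ip N (e \<omega>) (e \<omega>) \<le> 2 * \<mu> / l * ip R (mv M x) (mv M x) +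
    40 * real n * \<tau> * (op_norm2 C)\<^sup>2 * ((\<Sum>t = 1..T - 1. 1 / (l + \<mu> * eig L t)\<^sup>2) + 1 / l\<^sup>2) * t}
    \<ge> 1 - exp (- t)"
proof -
  interpret Y: subgaussian_vector Pr Q \<tau> Y by (rule Y)
  obtain V where V: "eigenbasis_with_kernel B N V T z" by (rule eigenbasis_B)
  interpret B: eigenbasis_with_kernel B N V T z by (rule V)
  define \<kappa> where "\<kappa> = (\<lambda>k. inverse (eig B (Suc k)))"
  \<comment> \<open>Chosen so that \<open>ip Q (a k) (Y \<omega>)\<close> is the coordinate of the
    filtered noise along \<open>V k\<close>.\<close>
  define a where "a = (\<lambda>k q. \<kappa> k * mv C (V k) q)"
  define S where "S = (\<Sum>t = 1..T - 1. 1 / (l + \<mu> * eig L t)\<^sup>2) + 1 / l\<^sup>2"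
  define r where "r = (op_norm2 C)\<^sup>2 * (4 * real n * S)"
  have trace: "(\<Sum>k<N. ip Q (a k) (a k)) \<le> r"
  proof -
    have "(\<Sum>k<N. ip Q (a k) (a k)) \<le> (\<Sum>k<N. (\<kappa> k)\<^sup>2 * (op_norm2 C)\<^sup>2)"
    proof (intro sum_mono)
      fix k assume "k \<in> {..<N}"
      then have "ip Q (mv C (V k)) (mv C (V k)) \<le> (op_norm2 C)\<^sup>2"
        using op_norm2_bound(1)[OF C_carrier, of "V k"] B.norm_basis by simp
      then have "(\<kappa> k)\<^sup>2 * ip Q (mv C (V k)) (mv C (V k)) \<le> (\<kappa> k)\<^sup>2 * (op_norm2 C)\<^sup>2"
        by (intro mult_left_mono) auto
      then show "ip Q (a k) (a k) \<le> (\<kappa> k)\<^sup>2 * (op_norm2 C)\<^sup>2"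
        unfolding a_def ip_simps by (simp add: power2_eq_square mult.assoc)
    qed
    also have "\<dots> = (op_norm2 C)\<^sup>2 * (\<Sum>k<N. (\<kappa> k)\<^sup>2)"
      by (simp add: sum_distrib_left mult.commute)
    also have "\<dots> \<le> r"
      unfolding r_def \<kappa>_def S_def using sum_inverse_eig_square_le[OF V l coercive]
      by (intro mult_left_mono) auto
    finally show ?thesis .
  qed
  have e_le: "ip N (e \<omega>) (e \<omega>) \<le> 2 * \<mu> / l * ip R (mv M x) (mv M x) + 2 * (\<Sum>k<N. (ip Q (a k) (Y \<omega>))\<^sup>2)" for \<omega>
  proof -
    have form: "ip N v (mv B w) = \<mu> * ip R (mv M v) (mv M w) + ip Q (mv C v) (mv C w)"
      if "orth_to N T z v" "orth_to N T z w" for v w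
      using ip_B[OF that] by (simp add: energy_def)
    have "l * ip N v v \<le> ip N v (mv B v)" if "orth_to N T z v" for v
      using coercive[OF that] ip_B[OF that that] by simp
    from B.ridge_error_le[OF l \<mu> this M_carrier C_carrier form x, of "Y \<omega>"]
    show ?thesis
      unfolding e_def a_def ip_simps \<kappa>_def by (simp add: power_mult_distrib)
  qed
  let ?good = "{\<omega> \<in> space Pr. (\<Sum>k<N. (ip Q (a k) (Y \<omega>))\<^sup>2) \<le> 5 * \<tau> * r * t}"
  let ?goal = "{\<omega> \<in> space Pr. ip N (e \<omega>) (e \<omega>) \<le> 2 * \<mu> / l * ip R (mv M x) (mv M x) +
    40 * real n * \<tau> * (op_norm2 C)\<^sup>2 * S * t}"
  have "1 - exp (- t) \<le> Y.prob ?good" by (rule Y.quadratic_tail[OF trace t])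
  also have "\<dots> \<le> Y.prob ?goal"
  proof (rule Y.finite_measure_mono)
    show "?good \<subseteq> ?goal"
    proof
      fix \<omega> assume good: "\<omega> \<in> ?good"
      \<comment> \<open>The constant is \<open>40 = 2 * 5 * 4\<close>: the split into bias and
        noise, the tail bound, and the sum of inverse squares.\<close>
      have "2 * (\<Sum>k<N. (ip Q (a k) (Y \<omega>))\<^sup>2) \<le> 40 * real n * \<tau> * (op_norm2 C)\<^sup>2 * S * t"
        using good by (simp add: r_def mult_ac)
      with e_le[of \<omega>] have "ip N (e \<omega>) (e \<omega>) \<le> 2 * \<mu> / l * ip R (mv M x) (mv M x) +
          40 * real n * \<tau> * (op_norm2 C)\<^sup>2 * S * t" by linarith
      with good show "\<omega> \<in> ?goal" by simp
    qed
    have [measurable]: "(\<lambda>\<omega>. e \<omega> i) \<in> borel_measurable Pr" for i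
      unfolding e_def by (rule estimation_error_measurable[OF Y])
    show "?goal \<in> Y.events" unfolding ip_def by measurable
  qed
  finally show ?thesis by (simp add: S_def)
qed

end

section \<open>Transfer to library vectors and assembly of the two claims\<close>

theorem theorem2:
  fixes n T :: nat
    and es :: "(nat \<times> nat) list"
    and est :: "nat \<Rightarrow> (nat \<times> nat) list"
    and xt :: "nat \<Rightarrow> real vec"
    and Pr :: "'a measure"
    and \<eta> :: "'a \<Rightarrow> real vec"
    and \<sigma> S_T b1 b2 b3 \<mu> :: real
  defines "L \<equiv> transpose_mat (inc_mat T es) * (inc_mat T es)"
    and "M \<equiv> kron (inc_mat T es) (1\<^sub>m n)"
    and "C \<equiv> block_diag T (\<lambda>t. inc_mat n (est t))"
    and "OTO \<equiv> mat_sum n T (\<lambda>t. transpose_mat (inc_mat n (est t)) * inc_mat n (est t))"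
    and "P \<equiv> kron (1\<^sub>m T) (1\<^sub>m n - (1 / real n) \<cdot>\<^sub>m mat n n (\<lambda>_. 1))"
    and "x \<equiv> stack_vec T xt"
    and "lbar \<equiv> max (lam_bar' b1 b2 b3 \<mu>) (eig (transpose_mat (block_diag T (\<lambda>t. inc_mat n (est t))) * (block_diag T (\<lambda>t. inc_mat n (est t)))) (T * (n - 1)))"
  assumes "n \<ge> 2" and "T \<ge> 2"
    and "simple_oriented_graph T es" and "graph_connected T es"
    and "\<forall>t<T. simple_oriented_graph n (est t)"
    and "\<forall>t<T. xt t \<in> carrier_vec n \<and> (\<Sum>i<n. vec_index (xt t) i) = 0"
    and "prob_space Pr"
    and "eig OTO (n - 1) > 0"
    and "centered_subgaussian_vec Pr (dim_row C) \<sigma> \<eta>"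
    and "vnorm (M *\<^sub>v x) ^ 2 \<le> S_T"
    and "b1 > 0" and "b2 > 0" and "b3 > 0"
    and "eig L (T - 1) \<ge> b1"
    and "eig OTO (n - 1) / real T \<ge> b2"
    and "2 * op_norm2 C * sqrt (eig OTO 1) / sqrt (real T) \<le> b3"
    and "\<mu> > 0"
  shows "eig (P * (\<mu> \<cdot>\<^sub>m (transpose_mat M * M) + transpose_mat C * C) * P) (T * (n - 1)) \<ge> lbar
         \<and> lam_bar' b1 b2 b3 \<mu> > 0
         \<and> (\<mu> * b1 \<ge> b2 + b3^2 / b2 \<longrightarrow> lam_bar' b1 b2 b3 \<mu> \<ge> b2 / 4)
         \<and> (\<forall>\<delta>. 0 < \<delta> \<and> \<delta> < exp (-1) \<longrightarrow>
              measure Pr {\<omega> \<in> space Pr. vnorm ((pinv (P * (\<mu> \<cdot>\<^sub>m (transpose_mat M * M) + transpose_mat C * C) * P) *\<^sub>v (transpose_mat C *\<^sub>v (C *\<^sub>v x + \<eta> \<omega>))) - x) ^ 2 \<le>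
                 4 * \<mu> / lbar * S_T
                 + 40 * real n * \<sigma>^2 * (op_norm2 C)^2 *
                   ((\<Sum>t = 1..T - 1. 1 / (lbar + \<mu> * eig L t)^2) + 1 / lbar^2) * ln (1 / \<delta>)}
                \<ge> 1 - \<delta>)"
proof -
  interpret net: dynamic_network n T es est \<mu>
    using assms(8-10) assms(12) \<open>\<mu> > 0\<close> by unfold_locales auto
  have eqs: "L = net.L" "M = net.M" "C = net.C" "OTO = net.OTO" "P = net.P"
    by (simp_all add: L_def M_def C_def OTO_def P_def net.L_def net.M_def net.C_def net.OTO_def net.P_def)
  have B: "P * (\<mu> \<cdot>\<^sub>m (transpose_mat M * M) + transpose_mat C * C) * P = net.B"
    by (simp add: eqs net.B_def net.H_def)
  let ?lam = "lam_bar' b1 b2 b3 \<mu>"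
  have lbar: "lbar = max ?lam (eig (transpose_mat net.C * net.C) (T * (n - 1)))"
    by (simp add: lbar_def net.C_def)
  have lam_pos: "?lam > 0" using assms(18-20) \<open>\<mu> > 0\<close> by (intro lam_bar'_pos)
  then have lbar_pos: "lbar > 0" by (simp add: lbar less_max_iff_disj)
  have coercive: "lbar * ip net.N v v \<le> net.energy v v" if v: "orth_to net.N T net.z v" for v
  proof -
    \<comment> \<open>\<open>energy_ge\<close> holds with twice \<open>?lam\<close>; the factor is
      given up so that both branches of the maximum obey one bound.\<close>
    have "?lam * ip net.N v v \<le> 2 * ?lam * ip net.N v v"
      using lam_pos by (intro mult_right_mono) auto
    also have "\<dots> \<le> net.energy v v"
      using assms(18-23) v unfolding eqs by (intro net.energy_ge)
    finally show ?thesis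
      using net.energy_ge_gram_C[OF v] by (simp add: lbar max_def)
  qed
  obtain V where V: "eigenbasis_with_kernel net.B net.N V T net.z" by (rule net.eigenbasis_B)
  interpret B: eigenbasis_with_kernel net.B net.N V T net.z by (rule V)
  have eig_ge: "eig net.B (T * (n - 1)) \<ge> lbar"
    using B.eig_ge_of_coercive[OF lbar_pos] coercive net.ip_B by (simp add: net.N_minus_T)
  have xt: "xt t \<in> carrier_vec n" "(\<Sum>i<n. xt t $ i) = 0" if "t < T" for t
    using assms(13) that by auto
  have x: "x \<in> carrier_vec net.N" "\<And>t i. t < T \<Longrightarrow> i < n \<Longrightarrow> x $ (t * n + i) = xt t $ i"
    unfolding x_def using stack_vec_index[of T xt n] xt by auto
  have x_orth: "orth_to net.N T net.z (($) x)"
    unfolding net.orth_to_z using x xt by simp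
  have C: "net.C \<in> carrier_mat net.Q net.N" by (rule net.C_carrier)
  have sub: "centered_subgaussian_vec Pr net.Q \<sigma> \<eta>"
    using assms(16) C by (simp add: eqs)
  have Y: "subgaussian_vector Pr net.Q (\<sigma>\<^sup>2) (\<lambda>\<omega>. ($) (\<eta> \<omega>))"
  proof -
    have mgf: "(\<integral>\<^sup>+\<omega>. ennreal (exp (s * ip net.Q u (($) (\<eta> \<omega>)))) \<partial>Pr) \<le> ennreal (exp (s\<^sup>2 * \<sigma>\<^sup>2 / 2))"
      if u: "ip net.Q u u = 1" for s u
    proof -
      let ?u = "Matrix.vec net.Q u"
      have "(vnorm ?u)\<^sup>2 = ip net.Q (($) ?u) (($) ?u)" by (simp add: vnorm_square)
      also have "\<dots> = ip net.Q u u" by (intro ip_cong) auto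
      also note u
      finally have "(vnorm ?u)\<^sup>2 = 1" .
      then have "vnorm ?u = 1" using vnorm_nonneg[of ?u] by (simp add: power2_eq_1_iff)
      then have "(\<integral>\<^sup>+\<omega>. ennreal (exp (s * scalar_prod ?u (\<eta> \<omega>))) \<partial>Pr) \<le> ennreal (exp (s\<^sup>2 * \<sigma>\<^sup>2 / 2))"
        using sub unfolding centered_subgaussian_vec_def by simp
      moreover have "scalar_prod ?u (\<eta> \<omega>) = ip net.Q u (($) (\<eta> \<omega>))" if "\<omega> \<in> space Pr" for \<omega>
      proof -
        have "\<eta> \<omega> \<in> carrier_vec net.Q" using sub that by (simp add: centered_subgaussian_vec_def)
        then show ?thesis by (simp add: scalar_prod_def ip_def atLeast0LessThan)
      qed
      ultimately show ?thesis by (simp cong: nn_integral_cong)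
    qed
    then show ?thesis
      using assms(14) sub
      by (simp add: subgaussian_vector_def subgaussian_vector_axioms_def centered_subgaussian_vec_def)
  qed
  have Mx: "ip net.R (mv net.M (($) x)) (mv net.M (($) x)) \<le> S_T"
  proof -
    have "(vnorm (M *\<^sub>v x))\<^sup>2 = ip net.R (mv net.M (($) x)) (mv net.M (($) x))"
      unfolding vnorm_square using net.M_carrier x(1) by (auto simp: eqs intro!: ip_cong mv_index)
    then show ?thesis using assms(17) by simp
  qed
  define e where "e = (\<lambda>\<omega> i. mv (pinv net.B) (mv (transpose_mat net.C) (\<lambda>q. mv net.C (($) x) q + \<eta> \<omega> $ q)) i - x $ i)"
  have error: "(vnorm (pinv net.B *\<^sub>v (transpose_mat C *\<^sub>v (C *\<^sub>v x + \<eta> \<omega>)) - x))\<^sup>2 = ip net.N (e \<omega>) (e \<omega>)"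
    if "\<omega> \<in> space Pr" for \<omega>
  proof -
    have \<eta>: "\<eta> \<omega> \<in> carrier_vec net.Q" using sub that by (simp add: centered_subgaussian_vec_def)
    have K: "pinv net.B \<in> carrier_mat net.N net.N" by (simp add: B.pinv_eq)
    have y: "C *\<^sub>v x + \<eta> \<omega> \<in> carrier_vec net.Q" unfolding eqs
      using C \<eta> x(1) by (intro add_carrier_vec mult_mat_vec_carrier)
    have inner: "mv (transpose_mat net.C) (($) (C *\<^sub>v x + \<eta> \<omega>)) =
        mv (transpose_mat net.C) (\<lambda>q. mv net.C (($) x) q + \<eta> \<omega> $ q)"
      using C \<eta> x(1) by (intro mv_cong) (auto simp: eqs mv_index simp del: index_mult_mat_vec)
    have outer: "mv (pinv net.B) (($) (transpose_mat C *\<^sub>v (C *\<^sub>v x + \<eta> \<omega>))) =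
        mv (pinv net.B) (mv (transpose_mat net.C) (($) (C *\<^sub>v x + \<eta> \<omega>)))"
      using C K y by (intro mv_cong) (auto simp: eqs mv_index simp del: index_mult_mat_vec)
    have w: "transpose_mat C *\<^sub>v (C *\<^sub>v x + \<eta> \<omega>) \<in> carrier_vec net.N"
      by (rule mult_mat_vec_carrier[OF _ y]) (use C eqs in simp)
    have "(pinv net.B *\<^sub>v (transpose_mat C *\<^sub>v (C *\<^sub>v x + \<eta> \<omega>)) - x) $ i = e \<omega> i" if "i < net.N" for i
      using that K x(1) w mv_index[of "transpose_mat C *\<^sub>v (C *\<^sub>v x + \<eta> \<omega>)" "pinv net.B" i]
      by (simp add: e_def outer inner)
    then show ?thesis
      unfolding vnorm_square using K x(1) by (auto intro!: ip_cong)
  qed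
  have prob: "1 - \<delta> \<le> measure Pr {\<omega> \<in> space Pr.
      vnorm ((pinv net.B *\<^sub>v (transpose_mat C *\<^sub>v (C *\<^sub>v x + \<eta> \<omega>))) - x) ^ 2 \<le> 4 * \<mu> / lbar * S_T
        + 40 * real n * \<sigma>^2 * (op_norm2 C)^2 *
          ((\<Sum>t = 1..T - 1. 1 / (lbar + \<mu> * eig L t)^2) + 1 / lbar^2) * ln (1 / \<delta>)}"
    if \<delta>: "0 < \<delta>" "\<delta> < exp (- 1)" for \<delta>
  proof -
    interpret prob_space Pr by fact
    \<comment> \<open>The condition on \<delta> is exactly \<open>t > 1\<close> for
      \<open>t = ln (1 / \<delta>)\<close>.\<close>
    have ln: "ln (1 / \<delta>) > 1" "exp (- ln (1 / \<delta>)) = \<delta>"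
      using \<delta> ln_less_cancel_iff[of \<delta> "exp (- 1)"] by (simp_all add: ln_div)
    let ?noise = "40 * real n * \<sigma>\<^sup>2 * (op_norm2 net.C)\<^sup>2 *
      ((\<Sum>t = 1..T - 1. 1 / (lbar + \<mu> * eig net.L t)\<^sup>2) + 1 / lbar\<^sup>2) * ln (1 / \<delta>)"
    \<comment> \<open>\<open>estimation_error\<close> has the smaller factor
      \<open>2 * \<mu> / lbar\<close>, so doubling it only enlarges the event.\<close>
    have bias: "2 * \<mu> / lbar * ip net.R (mv net.M (($) x)) (mv net.M (($) x)) \<le> 4 * \<mu> / lbar * S_T"
    proof (intro mult_mono divide_right_mono)
      show "0 \<le> ip net.R (mv net.M (($) x)) (mv net.M (($) x))" by simp
    qed (use Mx lbar_pos \<open>\<mu> > 0\<close> in auto)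
    have "1 - \<delta> \<le> prob {\<omega> \<in> space Pr. ip net.N (e \<omega>) (e \<omega>) \<le>
        2 * \<mu> / lbar * ip net.R (mv net.M (($) x)) (mv net.M (($) x)) + ?noise}"
      using net.estimation_error[OF Y lbar_pos coercive x_orth ln(1)] unfolding e_def ln(2) .
    also have "\<dots> \<le> prob {\<omega> \<in> space Pr. ip net.N (e \<omega>) (e \<omega>) \<le> 4 * \<mu> / lbar * S_T + ?noise}"
    proof (rule finite_measure_mono)
      \<comment> \<open>Monotonicity of the probability requires the larger event to be
        measurable.\<close>
      have [measurable]: "(\<lambda>\<omega>. e \<omega> i) \<in> borel_measurable Pr" for i
        unfolding e_def by (rule net.estimation_error_measurable[OF Y])
      show "{\<omega> \<in> space Pr. ip net.N (e \<omega>) (e \<omega>) \<le> 4 * \<mu> / lbar * S_T + ?noise} \<in> events"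
        unfolding ip_def by measurable
    qed (use bias in auto)
    also have "{\<omega> \<in> space Pr. ip net.N (e \<omega>) (e \<omega>) \<le> 4 * \<mu> / lbar * S_T + ?noise} = {\<omega> \<in> space Pr.
      vnorm ((pinv net.B *\<^sub>v (transpose_mat C *\<^sub>v (C *\<^sub>v x + \<eta> \<omega>))) - x) ^ 2 \<le> 4 * \<mu> / lbar * S_T + ?noise}"
      using error by auto
    finally show ?thesis by (simp only: eqs)
  qed
  show ?thesis
    unfolding B using eig_ge lam_pos prob lam_bar'_ge[OF assms(19,20)] by blast
qed

end
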